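(* Let $D(t)$, $t\in\mathbb{R}$, be a non-stationary switch process with switching times $T_+$, $T_-$ and expected value functions $E_+$, $E_-$ such that $-E_+'(t)$ and $E_-'(t)$ are non-negative for $t>0$. Then the time from a switch until the process returns to that state has the stochastic representation $$T_- + T_+ \stackrel{d}{=} \sum_{k=1}^{\nu_\beta} X_k + \sum_{k=1}^{\nu_\alpha} Y_k ,$$ where $\nu_\alpha$ and $\nu_\beta$ are independent and geometrically distributed with the parameters $$\alpha=\frac{\mu_-}{\mu_++\mu_-},\qquad \beta=\frac{\mu_+}{\mu_++\mu_-},$$ respectively, and the densities of $X_i$ and $Y_i$ are given by $$f_X(t)=-\frac{1}{2\alpha}E_+'(t),\qquad f_Y(t)=\frac{1}{2\beta}E_-'(t),$$ respectively. The sequences $(X_i)$ and $(Y_i)$ are mutually independent sequences of iid random variables, which are also independent of $\nu_\alpha$ and $\nu_\beta$.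
   Context: Switching times: $T_+$ and $T_-$ are independent non-negative random variables with no atom at zero, absolutely continuous with densities $f_+$, $f_-$, with support the entire non-negative half-line, and with finite expectations $\mu_+=\mathbb{E}T_+$, $\mu_-=\mathbb{E}T_-$. It is also assumed that there is $m\in\mathbb{N}$ with $\sup_{t>0}(f_+\ast f_-)^{\ast m}(t)<\infty$, where $\ast$ is convolution of functions and $\ast m$ the $m$-fold convolution power. Non-stationary switch process $D(t)$: let $(T_i^+)_{i\in\mathbb{N}}$ and $(T_i^-)_{i\in\mathbb{N}}$ be mutually independent sequences of iid copies of $T_+$ and $T_-$, and let $\delta\in\{-1,1\}$ be a random variable independent of them. If $\delta=1$, then $D=1$ on $[0,T_1^+)$, $D=-1$ on $[T_1^+,T_1^++T_1^-)$, then $D=1$ for a time $T_2^+$, $D=-1$ for a time $T_2^-$, and so on. If $\delta=-1$, then $D=-1$ on $[0,T_1^-)$, $D=1$ on $[T_1^-,T_1^-+T_1^+)$, and so on, alternately. The process is extended to the negative half-line in the same way, using further independent copies $T^{\pm}_{-i}$: if $\delta=1$, $D=-1$ on $[-T_{-1}^-,0)$, $D=1$ on $[-(T_{-1}^++T_{-1}^-),-T_{-1}^-)$, and so on; if $\delta=-1$ the roles of the two states are exchanged. Expected value functions: $E_+(t)=\mathbb{E}(D(t)\mid\delta=1)$, $E_-(t)=\mathbb{E}(D(t)\mid\delta=-1)$, $t>0$, with $E_+(0)=1$ and $E_-(0)=-1$; primes denote derivatives in $t$. A geometric variable $\nu_p$ with parameter $p\in(0,1)$ has $\mathbb{P}(\nu_p=k)=(1-p)^{k-1}p$,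 $k=1,2,\dots$. The symbol $\stackrel{d}{=}$ denotes equality in distribution. *)

theory Defs
  imports "HOL-Probability.Probability"
begin

definition measure_support :: "'a::topological_space measure \<Rightarrow> 'a set" where
  "measure_support \<mu> = {x. \<forall>U. open U \<and> x \<in> U \<longrightarrow> emeasure \<mu> U \<noteq> 0}"

text \<open>Convolution is taken in \<^typ>\<open>ennreal\<close>, so that a divergent convolution integral has
  the value \<open>\<infinity>\<close> (the Bochner integral would give \<open>0\<close>) and boundedness keeps its meaning.\<close>

definition conv :: "(real \<Rightarrow> ennreal) \<Rightarrow> (real \<Rightarrow> ennreal) \<Rightarrow> real \<Rightarrow> ennreal" where
  "conv f g x = (\<integral>\<^sup>+ y. f (x - y) * g y \<partial>lborel)"

text \<open>The \<open>m\<close>-fold convolution power, meaningful for \<open>m \<ge> 1\<close>.\<close>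

definition conv_power :: "(real \<Rightarrow> ennreal) \<Rightarrow> nat \<Rightarrow> real \<Rightarrow> ennreal" where
  "conv_power f m = (conv f ^^ (m - 1)) f"

definition switching_time :: "'p measure \<Rightarrow> ('p \<Rightarrow> real) \<Rightarrow> (real \<Rightarrow> real) \<Rightarrow> bool" where
  "switching_time P T f \<longleftrightarrow>
     T \<in> borel_measurable P \<and>
     (\<forall>\<omega>\<in>space P. 0 \<le> T \<omega>) \<and>
     measure P {\<omega>\<in>space P. T \<omega> = 0} = 0 \<and>
     (\<forall>t. 0 \<le> f t) \<and>
     distributed P lborel T (\<lambda>t. ennreal (f t)) \<and>
     measure_support (distr P borel T) = {0..} \<and>
     integrable P T"

definition switching_times ::
  "'p measure \<Rightarrow> ('p \<Rightarrow> real) \<Rightarrow> ('p \<Rightarrow> real) \<Rightarrow> (real \<Rightarrow> real) \<Rightarrow> (real \<Rightarrow> real) \<Rightarrow> bool" where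
  "switching_times P Tp Tm fp fm \<longleftrightarrow>
     prob_space P \<and>
     prob_space.indep_var P borel Tp borel Tm \<and>
     switching_time P Tp fp \<and>
     switching_time P Tm fm \<and>
     (\<exists>m\<ge>1. (SUP t\<in>{0<..}.
        conv_power (conv (\<lambda>s. ennreal (fp s)) (\<lambda>s. ennreal (fm s))) m t) < \<infinity>)"

text \<open>\<open>Plus i\<close> and \<open>Minus i\<close> index the copies \<open>T_i^+\<close> and \<open>T_i^-\<close>, with \<open>i \<noteq> 0\<close>: positive
  indices are used on the positive half-line, negative ones on the negative half-line.\<close>

datatype switch_index = Start | Plus int | Minus int

fun switch_family :: "('a \<Rightarrow> real) \<Rightarrow> (int \<Rightarrow> 'a \<Rightarrow> real) \<Rightarrow> (int \<Rightarrow> 'a \<Rightarrow> real) \<Rightarrow>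
    switch_index \<Rightarrow> 'a \<Rightarrow> real" where
  "switch_family \<delta> Tps Tms Start = \<delta>"
| "switch_family \<delta> Tps Tms (Plus i) = Tps i"
| "switch_family \<delta> Tps Tms (Minus i) = Tms i"

definition switch_data ::
  "'p measure \<Rightarrow> ('p \<Rightarrow> real) \<Rightarrow> ('p \<Rightarrow> real) \<Rightarrow>
   'a measure \<Rightarrow> ('a \<Rightarrow> real) \<Rightarrow> (int \<Rightarrow> 'a \<Rightarrow> real) \<Rightarrow> (int \<Rightarrow> 'a \<Rightarrow> real) \<Rightarrow> bool" where
  "switch_data P Tp Tm M \<delta> Tps Tms \<longleftrightarrow>
     prob_space M \<and>
     (\<forall>\<omega>\<in>space M. \<delta> \<omega> \<in> {-1, 1}) \<and>
     prob_space.indep_vars M (\<lambda>_. borel) (switch_family \<delta> Tps Tms)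
       ({Start} \<union> Plus ` {i. i \<noteq> 0} \<union> Minus ` {i. i \<noteq> 0}) \<and>
     (\<forall>i. i \<noteq> 0 \<longrightarrow> distr M borel (Tps i) = distr P borel Tp) \<and>
     (\<forall>i. i \<noteq> 0 \<longrightarrow> distr M borel (Tms i) = distr P borel Tm)"

text \<open>The partial sums \<open>0, a 0, a 0 + b 0, a 0 + b 0 + a 1, \<dots>\<close> of alternating durations.\<close>

definition switch_epoch :: "(nat \<Rightarrow> real) \<Rightarrow> (nat \<Rightarrow> real) \<Rightarrow> nat \<Rightarrow> real" where
  "switch_epoch a b n = (\<Sum>k<n. if even k then a (k div 2) else b (k div 2))"

text \<open>The sign of a path, relative to the state it occupies next to the origin, on the positive
  half-line (\<open>t \<ge> 0\<close>) and on the negative half-line (\<open>t < 0\<close>).  Almost surely the epochs increase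
  strictly to infinity, so that exactly one \<open>n\<close> qualifies; \<^const>\<open>Least\<close> keeps the sign measurable on
  the exceptional null set as well.\<close>

definition forward_sign :: "(nat \<Rightarrow> real) \<Rightarrow> (nat \<Rightarrow> real) \<Rightarrow> real \<Rightarrow> real" where
  "forward_sign a b t =
     (-1) ^ (LEAST n. switch_epoch a b n \<le> t \<and> t < switch_epoch a b (Suc n))"

definition backward_sign :: "(nat \<Rightarrow> real) \<Rightarrow> (nat \<Rightarrow> real) \<Rightarrow> real \<Rightarrow> real" where
  "backward_sign a b t =
     (-1) ^ (LEAST n. - switch_epoch a b (Suc n) \<le> t \<and> t < - switch_epoch a b n)"

definition switch_process ::
  "('a \<Rightarrow> real) \<Rightarrow> (int \<Rightarrow> 'a \<Rightarrow> real) \<Rightarrow> (int \<Rightarrow> 'a \<Rightarrow> real) \<Rightarrow> real \<Rightarrow> 'a \<Rightarrow> real" where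
  "switch_process \<delta> Tps Tms t \<omega> =
    (let fwd_p = (\<lambda>k. Tps (int k + 1) \<omega>); fwd_m = (\<lambda>k. Tms (int k + 1) \<omega>);
         bwd_p = (\<lambda>k. Tps (- (int k + 1)) \<omega>); bwd_m = (\<lambda>k. Tms (- (int k + 1)) \<omega>)
     in if \<delta> \<omega> = 1
        then (if 0 \<le> t then forward_sign fwd_p fwd_m t else - backward_sign bwd_m bwd_p t)
        else (if 0 \<le> t then - forward_sign fwd_m fwd_p t else backward_sign bwd_p bwd_m t))"

text \<open>The expected value function \<open>E(D(t) | \<delta> = s)\<close>, conditioning on an event of positive
  probability.  The values \<open>E_+(0) = 1\<close>, \<open>E_-(0) = -1\<close> come out of the definition, as the first
  durations are almost surely positive.\<close>

definition expected_value ::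
  "'a measure \<Rightarrow> ('a \<Rightarrow> real) \<Rightarrow> (real \<Rightarrow> 'a \<Rightarrow> real) \<Rightarrow> real \<Rightarrow> real \<Rightarrow> real" where
  "expected_value M \<delta> D s t =
     (\<integral>\<omega>. D t \<omega> \<partial>uniform_measure M {\<omega>\<in>space M. \<delta> \<omega> = s})"

text \<open>The function \<open>c E'\<close> on \<open>(0, \<infinity>)\<close>, as a density on the line.  For \<open>E\<close> one of the expected value
  functions, which are absolutely continuous on \<open>[0, \<infinity>)\<close>, the points of non-differentiability
  form a null set.\<close>

definition scaled_deriv :: "real \<Rightarrow> (real \<Rightarrow> real) \<Rightarrow> real \<Rightarrow> real" where
  "scaled_deriv c E t = (if 0 < t \<and> E differentiable (at t) then c * deriv E t else 0)"

definition geometric_rv :: "'n measure \<Rightarrow> real \<Rightarrow> ('n \<Rightarrow> nat) \<Rightarrow> bool" where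
  "geometric_rv N p \<nu> \<longleftrightarrow>
     \<nu> \<in> measurable N (count_space UNIV) \<and>
     (\<forall>k\<ge>1. measure N {\<omega>\<in>space N. \<nu> \<omega> = k} = (1 - p) ^ (k - 1) * p)"

datatype sum_index = Nu_alpha | Nu_beta | X_idx nat | Y_idx nat

fun sum_family :: "('n \<Rightarrow> nat) \<Rightarrow> ('n \<Rightarrow> nat) \<Rightarrow> (nat \<Rightarrow> 'n \<Rightarrow> real) \<Rightarrow> (nat \<Rightarrow> 'n \<Rightarrow> real) \<Rightarrow>
    sum_index \<Rightarrow> 'n \<Rightarrow> real" where
  "sum_family \<nu>a \<nu>b X Y Nu_alpha = (\<lambda>\<omega>. real (\<nu>a \<omega>))"
| "sum_family \<nu>a \<nu>b X Y Nu_beta = (\<lambda>\<omega>. real (\<nu>b \<omega>))"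
| "sum_family \<nu>a \<nu>b X Y (X_idx k) = X k"
| "sum_family \<nu>a \<nu>b X Y (Y_idx k) = Y k"

definition geometric_sum_data ::
  "real \<Rightarrow> real \<Rightarrow> (real \<Rightarrow> real) \<Rightarrow> (real \<Rightarrow> real) \<Rightarrow> 'n measure \<Rightarrow> ('n \<Rightarrow> nat) \<Rightarrow> ('n \<Rightarrow> nat) \<Rightarrow>
   (nat \<Rightarrow> 'n \<Rightarrow> real) \<Rightarrow> (nat \<Rightarrow> 'n \<Rightarrow> real) \<Rightarrow> bool" where
  "geometric_sum_data \<alpha> \<beta> fX fY N \<nu>a \<nu>b X Y \<longleftrightarrow>
     prob_space N \<and>
     geometric_rv N \<alpha> \<nu>a \<and>
     geometric_rv N \<beta> \<nu>b \<and>
     (\<forall>k\<ge>1. distributed N lborel (X k) (\<lambda>t. ennreal (fX t))) \<and>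
     (\<forall>k\<ge>1. distributed N lborel (Y k) (\<lambda>t. ennreal (fY t))) \<and>
     prob_space.indep_vars N (\<lambda>_. borel) (sum_family \<nu>a \<nu>b X Y)
       ({Nu_alpha, Nu_beta} \<union> X_idx ` {1..} \<union> Y_idx ` {1..})"

end

theory Submission
  imports Defs
begin

text \<open>
  Let \<open>p\<close>, \<open>m\<close> be the laws of \<open>T\<^sub>+\<close>, \<open>T\<^sub>-\<close>, let \<open>a\<close>, \<open>b\<close> be their characteristic functions, and let
  \<open>S\<^sub>n\<close> be the \<open>n\<close>-th switching epoch of a path that starts in the state \<open>1\<close>.  On such a path
  \<open>D(t) = (-1)\<^sup>n\<close> for \<open>S\<^sub>n \<le> t < S\<^sub>n\<^sub>+\<^sub>1\<close>.  Taking expectations and shifting the index turns this into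
  \<open>E\<^sub>+ = 1 - 2 G\<close> with \<open>G(t) = \<Sum>n. (-1)\<^sup>n P(S\<^sub>n\<^sub>+\<^sub>1 \<le> t)\<close> (lemma \<open>expected_value_eq_renewal_cdf\<close>).
  Since \<open>S\<^sub>n\<^sub>+\<^sub>2\<close> has the law of \<open>S\<^sub>n\<close> plus an independent full cycle, \<open>G\<close> solves a renewal equation
  whose kernel is the cycle law \<open>p \<star> m\<close> (lemma \<open>renewal_equation\<close>).

  If \<open>E\<^sub>+\<close> decreases, \<open>G\<close> is the distribution function of a finite measure, namely \<open>\<alpha>\<close> times the law of
  the \<open>X\<^sub>i\<close>.  Writing \<open>x\<close> for the characteristic function of that law, the renewal equation becomes
  \<open>\<alpha> x (1 - a b) = a (1 - b)\<close>; its first-order behaviour at \<open>0\<close> shows that \<open>x(0) = 1\<close> holds exactly for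
  the stated \<open>\<alpha>\<close>.  With the two states exchanged, \<open>\<beta> y (1 - a b) = b (1 - a)\<close> for the \<open>Y\<^sub>i\<close>
  (lemma \<open>normalised_renewal_density\<close>).  As \<open>\<alpha> + \<beta> = 1\<close>, the two geometric sums have the characteristic
  functions \<open>\<beta> x / (1 - \<alpha> x)\<close> and \<open>\<alpha> y / (1 - \<beta> y)\<close> (lemma \<open>char_geometric_sums\<close>).  Here
  \<open>1 - \<alpha> x = (1 - a) / (1 - a b)\<close> and \<open>1 - \<beta> y = (1 - b) / (1 - a b)\<close>, so everything cancels in the product
  of the two except \<open>a b\<close>, the characteristic function of \<open>T\<^sub>- + T\<^sub>+\<close>, and the uniqueness theorem for
  characteristic functions finishes the proof.

  The sign conditions concern the derivatives only where they exist, so \<open>G\<close> has to be recovered from its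
  derivative.  This is possible because \<open>G\<close> is an indefinite integral, by Lebesgue's differentiation
  theorem (lemma \<open>AE_deriv_integral\<close>).  That the derivative is a Borel function, as a density must be,
  is a separate point (lemma \<open>borel_measurable_scaled_deriv\<close>).
\<close>

section \<open>Differentiating indefinite integrals\<close>

text \<open>Every point of the set lies in arbitrarily short intervals on which the mean of \<open>g - q\<close> exceeds
  \<open>q' - q\<close>.  By Vitali's theorem, disjoint intervals of this kind cover the set up to a null set.
  They can be kept inside an open set \<open>U\<close> around \<open>{g \<le> q}\<close> on which the positive part of \<open>g - q\<close> has
  arbitrarily small integral, because that part vanishes on \<open>{g \<le> q}\<close>; so their total length is
  arbitrarily small.\<close>

lemma upper_derivate_gap_negligible:
  fixes g :: "real \<Rightarrow> real"
  assumes g: "integrable lborel g" and "q < q'"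
  shows "negligible {x \<in> {-K<..<K}. g x \<le> q \<and>
    (\<forall>d>0. \<exists>u v. u \<le> x \<and> x \<le> v \<and> u < v \<and> v - u < d \<and> q' * (v - u) < (LINT y:{u..v}|lborel. g y))}"
    (is "negligible ?E")
proof (rule negligible_outer_le[THEN iffD2], intro allI impI)
  fix e :: real assume "0 < e"
  have [measurable]: "g \<in> borel_measurable borel" using borel_measurable_integrable[OF g] by simp
  define w where "w y = ennreal (max 0 (g y - q)) * indicator {-K<..<K} y" for y
  define \<rho> where "\<rho> = density lborel w"
  have [measurable]: "w \<in> borel_measurable borel" unfolding w_def by measurable
  have sets_\<rho>[simp]: "sets \<rho> = sets borel" by (simp add: \<rho>_def)
  have emeasure_\<rho>: "emeasure \<rho> A = (\<integral>\<^sup>+y. w y * indicator A y \<partial>lborel)" if "A \<in> sets borel" for A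
    using that by (simp add: \<rho>_def emeasure_density)
  have "(\<integral>\<^sup>+y. w y \<partial>lborel) \<le>
      (\<integral>\<^sup>+y. ennreal (norm (g y)) + ennreal \<bar>q\<bar> * indicator {-K<..<K} y \<partial>lborel)"
    by (intro nn_integral_mono) (auto simp: w_def indicator_def ennreal_plus[symmetric] simp del: ennreal_plus intro!: ennreal_leI)
  also have "\<dots> = (\<integral>\<^sup>+y. ennreal (norm (g y)) \<partial>lborel) + ennreal \<bar>q\<bar> * emeasure lborel {-K<..<K}"
    by (simp add: nn_integral_add nn_integral_cmult_indicator)
  also have "\<dots> < \<infinity>"
    using g by (cases "-K \<le> K") (auto simp: integrable_iff_bounded ennreal_mult_less_top)
  finally have "emeasure \<rho> (space \<rho>) < \<infinity>" by (simp add: emeasure_\<rho> \<rho>_def emeasure_density)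
  then have fin: "emeasure \<rho> (space \<rho>) \<noteq> \<infinity>" by simp
  define A where "A = {x \<in> {-K<..<K}. g x \<le> q}"
  have [measurable]: "A \<in> sets borel" unfolding A_def by measurable
  have "emeasure \<rho> A = 0"
    by (simp add: emeasure_\<rho>) (intro nn_integral_zero' AE_I2, auto simp: w_def A_def indicator_def ennreal_neg)
  then have "(INF U \<in> {U. A \<subseteq> U \<and> open U}. emeasure \<rho> U) < ennreal (e * (q' - q))"
    using outer_regular[OF sets_\<rho> fin, of A] \<open>0 < e\<close> \<open>q < q'\<close> by simp
  then obtain U where U: "A \<subseteq> U" "open U" "emeasure \<rho> U < ennreal (e * (q' - q))"
    by (auto simp: INF_less_iff)
  \<comment> \<open>Intervals on which the mean of \<open>g\<close> exceeds \<open>q'\<close> carry \<open>\<rho>\<close>-mass at least \<open>(q' - q)\<close> times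
    their length.\<close>
  define good :: "(real \<times> real) set" where "good = {(c, r). 0 < r \<and> cball c r \<subseteq> U \<inter> {-K<..<K} \<and>
     q' * (2 * r) < (LINT y:cball c r|lborel. g y)}"
  have good_mass: "ennreal (q' - q) * emeasure lborel (cball (fst i) (snd i)) \<le> emeasure \<rho> (cball (fst i) (snd i))"
    if "i \<in> good" for i
  proof -
    obtain c r where i: "i = (c, r)" by (cases i)
    have r: "0 < r" "cball c r \<subseteq> U \<inter> {-K<..<K}" "q' * (2 * r) < (LINT y:cball c r|lborel. g y)"
      using that by (auto simp: good_def i)
    have cb: "cball c r = {c - r..c + r}" by (auto simp: cball_eq_atLeastAtMost)
    have int: "set_integrable lborel (cball c r) g"
      using g unfolding set_integrable_def by (intro integrable_mult_indicator) auto
    have intq: "set_integrable lborel (cball c r) (\<lambda>y. q)"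
      unfolding set_integrable_def cb by (intro integrable_scaleR_left) (simp add: integrable_indicator_iff emeasure_lborel_Icc_eq)
    have "(LINT y:cball c r|lborel. g y - q) = (LINT y:cball c r|lborel. g y) - q * (2 * r)"
      using r(1) by (subst set_integral_diff[OF int intq]) (simp add: set_lebesgue_integral_def cb)
    then have "(q' - q) * (2 * r) \<le> (LINT y:cball c r|lborel. g y - q)"
      using r by (simp add: algebra_simps)
    then have "ennreal ((q' - q) * (2 * r)) \<le> ennreal (LINT y:cball c r|lborel. g y - q)"
      by (rule ennreal_leI)
    also have "\<dots> \<le> (\<integral>\<^sup>+y. ennreal (indicator (cball c r) y * (g y - q)) \<partial>lborel)"
    proof -
      have ii: "integrable lborel (\<lambda>y. indicator (cball c r) y * (g y - q))"
        using set_integral_diff(1)[OF int intq] by (simp add: set_integrable_def)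
      have "(LINT y|lborel. indicator (cball c r) y * (g y - q)) \<le>
          (LINT y|lborel. max 0 (indicator (cball c r) y * (g y - q)))"
        using ii by (intro integral_mono) auto
      then have "ennreal (LINT y|lborel. indicator (cball c r) y * (g y - q)) \<le> ennreal \<dots>"
        by (rule ennreal_leI)
      also have "\<dots> = (\<integral>\<^sup>+y. ennreal (max 0 (indicator (cball c r) y * (g y - q))) \<partial>lborel)"
        using ii by (intro nn_integral_eq_integral[symmetric]) auto
      also have "\<dots> = (\<integral>\<^sup>+y. ennreal (indicator (cball c r) y * (g y - q)) \<partial>lborel)"
        by (simp add: max_def ennreal_neg) (intro nn_integral_cong, auto simp: ennreal_neg)
      finally show ?thesis by (simp add: set_lebesgue_integral_def)
    qed
    also have "\<dots> \<le> emeasure \<rho> (cball c r)"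
      unfolding emeasure_\<rho>[OF borel_closed[OF closed_cball]] using r(2)
      by (intro nn_integral_mono) (auto simp: w_def indicator_def subset_eq intro!: ennreal_leI)
    finally show ?thesis
      using r(1) \<open>q < q'\<close> by (simp add: i cb ennreal_mult[symmetric])
  qed
  have cover: "\<exists>i. i \<in> good \<and> x \<in> cball (fst i) (snd i) \<and> snd i < d" if x: "x \<in> ?E" and "0 < d" for x d
  proof -
    have "x \<in> U \<inter> {-K<..<K}" using x U(1) by (auto simp: A_def)
    moreover have "open (U \<inter> {-K<..<K})" using U by auto
    ultimately obtain \<eta> where \<eta>: "0 < \<eta>" "ball x \<eta> \<subseteq> U \<inter> {-K<..<K}"
      by (meson open_contains_ball)
    have *: "\<exists>u v. u \<le> x \<and> x \<le> v \<and> u < v \<and> v - u < d' \<and> q' * (v - u) < (LINT y:{u..v}|lborel. g y)"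
      if "0 < d'" for d' using x that by blast
    obtain u v where uv: "u \<le> x" "x \<le> v" "u < v" "v - u < min d \<eta>"
        "q' * (v - u) < (LINT y:{u..v}|lborel. g y)"
      using *[of "min d \<eta>"] \<open>0 < d\<close> \<eta> by auto
    have cb: "cball ((u + v) / 2) ((v - u) / 2) = {u..v}"
      by (auto simp: cball_eq_atLeastAtMost field_simps)
    have "{u..v} \<subseteq> ball x \<eta>" using uv by (auto simp: dist_real_def)
    then have "((u + v) / 2, (v - u) / 2) \<in> good"
      using uv \<eta> by (auto simp: good_def cb algebra_simps)
    moreover have "x \<in> cball ((u + v) / 2) ((v - u) / 2)" using uv by (simp add: cb)
    ultimately show ?thesis
      using uv by (intro exI[of _ "((u + v) / 2, (v - u) / 2)"]) auto
  qed
  have pos: "0 < snd i" if "i \<in> good" for i using that by (auto simp: good_def)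
  obtain C where C: "countable C" "C \<subseteq> good"
     "pairwise (\<lambda>i j. disjnt (cball (fst i) (snd i)) (cball (fst j) (snd j))) C"
     "negligible (?E - (\<Union>i \<in> C. cball (fst i) (snd i)))"
    by (rule Vitali_covering_theorem_cballs[where a=fst and r=snd and K=good and S="?E", OF pos cover that])
  have good_U: "cball (fst i) (snd i) \<subseteq> U" if "i \<in> good" for i
    using that by (auto simp: good_def)
  define V where "V = (\<Union>i \<in> C. cball (fst i) (snd i))"
  have disj: "disjoint_family_on (\<lambda>i. cball (fst i) (snd i)) C"
    using C(3) by (auto simp: disjoint_family_on_def pairwise_def disjnt_def)
  have [measurable]: "V \<in> sets borel" unfolding V_def using C(1) by (intro sets.countable_UN'') auto
  have "ennreal (q' - q) * emeasure lborel V =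
      (\<integral>\<^sup>+i. ennreal (q' - q) * emeasure lborel (cball (fst i) (snd i)) \<partial>count_space C)"
    unfolding V_def using C(1) disj by (subst emeasure_UN_countable) (auto simp: nn_integral_cmult)
  also have "\<dots> \<le> (\<integral>\<^sup>+i. emeasure \<rho> (cball (fst i) (snd i)) \<partial>count_space C)"
    using C(2) by (intro nn_integral_mono good_mass) auto
  also have "\<dots> = emeasure \<rho> V"
    unfolding V_def using C(1) disj by (subst emeasure_UN_countable) auto
  also have "\<dots> \<le> emeasure \<rho> U"
  proof (rule emeasure_mono)
    show "V \<subseteq> U" unfolding V_def using good_U C(2) by blast
  qed (use U(2) in simp)
  also have "\<dots> < ennreal (q' - q) * ennreal e"
    using U(3) \<open>0 < e\<close> \<open>q < q'\<close> by (simp add: ennreal_mult[symmetric] mult.commute)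
  finally have "emeasure lborel V < ennreal e"
    by (metis mult_left_mono not_less zero_le)
  then have "emeasure lebesgue V < ennreal e" by simp
  moreover have V: "V \<in> sets lebesgue" by (simp add: sets_completionI_sets)
  ultimately have V': "V \<in> lmeasurable" "measure lebesgue V \<le> e"
    using \<open>0 < e\<close> by (auto simp: fmeasurable_def measure_def less_top intro: less_trans) 
       (metis enn2real_mono ennreal_less_top enn2real_ennreal less_imp_le)
  have N: "negligible (?E - V)" using C(4) by (simp add: V_def)
  show "\<exists>T. ?E \<subseteq> T \<and> T \<in> lmeasurable \<and> measure lebesgue T \<le> e"
  proof (intro exI[of _ "V \<union> (?E - V)"] conjI)
    show "V \<union> (?E - V) \<in> lmeasurable"
      using V'(1) negligible_imp_measurable[OF N] by (rule fmeasurable.Un)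
    have "measure lebesgue (V \<union> (?E - V)) \<le> measure lebesgue V + measure lebesgue (?E - V)"
      by (rule measure_Un_le[OF fmeasurableD[OF V'(1)] fmeasurableD[OF negligible_imp_measurable[OF N]]])
    then show "measure lebesgue (V \<union> (?E - V)) \<le> e"
      using V'(2) negligible_imp_measure0[OF N] by linarith
  qed auto
qed

text \<open>A value \<open>q > g x\<close> exceeded by the means over arbitrarily short intervals would leave room for two rational numbers between
  \<open>g x\<close> and \<open>q\<close>, so countably many of the null sets above cover all exceptional points.\<close>

lemma AE_upper_derivate_le:
  fixes g :: "real \<Rightarrow> real"
  assumes g: "integrable lborel g"
  shows "AE x in lborel. \<forall>q>g x. \<exists>d>0. \<forall>u v. u \<le> x \<and> x \<le> v \<and> u < v \<and> v - u < d \<longrightarrow>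
    (LINT y:{u..v}|lborel. g y) \<le> q * (v - u)"
proof -
  define E where "E K q q' = {x \<in> {-K<..<K}. g x \<le> q \<and>
    (\<forall>d>0. \<exists>u v. u \<le> x \<and> x \<le> v \<and> u < v \<and> v - u < d \<and> q' * (v - u) < (LINT y:{u..v}|lborel. g y))}"
    for K q q' :: real
  have "AE x in lebesgue. x \<notin> E K q q'" if "q < q'" for K q q'
    using upper_derivate_gap_negligible[OF g that, of K]
    by (intro AE_not_in) (simp add: negligible_iff_null_sets E_def)
  then have *: "AE x in lebesgue. q < q' \<longrightarrow> x \<notin> E K q q'" for K q q'
    by (cases "q < q'") auto
  have "AE x in lebesgue. \<forall>K\<in>(UNIV::nat set). \<forall>q\<in>\<rat>. \<forall>q'\<in>\<rat>. q < q' \<longrightarrow> x \<notin> E (real K) q q'"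
    by (intro AE_ball_countable[THEN iffD2] ballI countable_rat countableI_type *)
  then have "AE x in lborel. \<forall>K\<in>(UNIV::nat set). \<forall>q\<in>\<rat>. \<forall>q'\<in>\<rat>. q < q' \<longrightarrow> x \<notin> E (real K) q q'"
    by (simp add: AE_completion_iff)
  then show ?thesis
  proof eventually_elim
    case (elim x)
    show ?case
    proof (intro allI impI)
      fix q assume "g x < q"
      obtain q2 where q2: "g x < q2" "q2 < q" "q2 \<in> \<rat>" using Rats_dense_in_real[OF \<open>g x < q\<close>] by auto
      obtain q1 where q1: "g x < q1" "q1 < q2" "q1 \<in> \<rat>" using Rats_dense_in_real[OF q2(1)] by auto
      obtain K :: nat where "\<bar>x\<bar> < real K" using reals_Archimedean2 by auto
      then have "x \<in> {- real K<..<real K}" by auto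
      moreover have "x \<notin> E (real K) q1 q2" using elim q1 q2 by blast
      ultimately obtain d where d: "0 < d"
        "\<And>u v. u \<le> x \<Longrightarrow> x \<le> v \<Longrightarrow> u < v \<Longrightarrow> v - u < d \<Longrightarrow> (LINT y:{u..v}|lborel. g y) \<le> q2 * (v - u)"
        using q1 by (force simp: E_def not_less)
      show "\<exists>d>0. \<forall>u v. u \<le> x \<and> x \<le> v \<and> u < v \<and> v - u < d \<longrightarrow> (LINT y:{u..v}|lborel. g y) \<le> q * (v - u)"
      proof (intro exI[of _ d] conjI allI impI d(1))
        fix u v assume uv: "u \<le> x \<and> x \<le> v \<and> u < v \<and> v - u < d"
        then have "q2 * (v - u) \<le> q * (v - u)" using q2 by (intro mult_right_mono) auto
        then show "(LINT y:{u..v}|lborel. g y) \<le> q * (v - u)" using d(2)[of u v] uv by (meson order_trans)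
      qed
    qed
  qed
qed

text \<open>Lebesgue's differentiation theorem on the line: the one-sided estimate is applied to \<open>g\<close> and to \<open>- g\<close>.\<close>

lemma AE_deriv_integral:
  fixes g :: "real \<Rightarrow> real"
  assumes g: "integrable lborel g"
  shows "AE x in lborel. ((\<lambda>t. LINT y:{..t}|lborel. g y) has_real_derivative g x) (at x)"
proof -
  define G where "G t = (LINT y:{..t}|lborel. g y)" for t
  have sint: "set_integrable lborel A g" if "A \<in> sets borel" for A
    using g that unfolding set_integrable_def by (intro integrable_mult_indicator) auto
  have diff: "G v - G u = (LINT y:{u..v}|lborel. g y)" if "u \<le> v" for u v
  proof -
    have "(LINT y:{..u} \<union> {u<..v}|lborel. g y) = G u + (LINT y:{u<..v}|lborel. g y)"
      unfolding G_def by (intro set_integral_Un sint) auto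
    moreover have "{..u} \<union> {u<..v} = {..v}" using that by auto
    moreover have "(LINT y:{u<..v}|lborel. g y) = (LINT y:{u..v}|lborel. g y)"
      unfolding set_lebesgue_integral_def using AE_lborel_singleton[of u] borel_measurable_integrable[OF g]
      by (intro integral_cong_AE) (auto elim!: eventually_mono simp: indicator_def)
    ultimately show ?thesis by (simp add: G_def)
  qed
  have "AE x in lborel. \<forall>q>- g x. \<exists>d>0. \<forall>u v. u \<le> x \<and> x \<le> v \<and> u < v \<and> v - u < d \<longrightarrow>
    (LINT y:{u..v}|lborel. - g y) \<le> q * (v - u)"
    using g by (intro AE_upper_derivate_le) simp
  with AE_upper_derivate_le[OF g] show ?thesis
  proof eventually_elim
    case (elim x)
    have "((\<lambda>h. (G (x + h) - G x) / h) \<longlongrightarrow> g x) (at 0)"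
    proof (rule LIM_I)
      fix e :: real assume e: "0 < e"
      obtain d1 where d1: "0 < d1" "\<And>u v. u \<le> x \<Longrightarrow> x \<le> v \<Longrightarrow> u < v \<Longrightarrow> v - u < d1 \<Longrightarrow>
          (LINT y:{u..v}|lborel. g y) \<le> (g x + e/2) * (v - u)"
        using elim(1)[rule_format, of "g x + e/2"] e by auto
      obtain d2 where d2: "0 < d2" "\<And>u v. u \<le> x \<Longrightarrow> x \<le> v \<Longrightarrow> u < v \<Longrightarrow> v - u < d2 \<Longrightarrow>
          (LINT y:{u..v}|lborel. - g y) \<le> (- g x + e/2) * (v - u)"
        using elim(2)[rule_format, of "- g x + e/2"] e by auto
      have bound: "\<bar>(G v - G u) / (v - u) - g x\<bar> < e"
        if "u \<le> x" "x \<le> v" "u < v" "v - u < min d1 d2" for u v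
      proof -
        have "(LINT y:{u..v}|lborel. - g y) = - (LINT y:{u..v}|lborel. g y)"
          by (simp add: set_lebesgue_integral_def)
        then have "G v - G u \<le> (g x + e/2) * (v - u)" "- (G v - G u) \<le> (- g x + e/2) * (v - u)"
          using d1(2)[of u v] d2(2)[of u v] that diff[of u v] by auto
        then have "(G v - G u) / (v - u) \<le> g x + e/2" "g x - e/2 \<le> (G v - G u) / (v - u)"
          using that by (auto simp: divide_le_eq le_divide_eq algebra_simps)
        then show ?thesis using e by auto
      qed
      show "\<exists>s>0. \<forall>h. h \<noteq> 0 \<and> norm (h - 0) < s \<longrightarrow> norm ((G (x + h) - G x) / h - g x) < e"
      proof (intro exI[of _ "min d1 d2"] conjI allI impI)
        fix h :: real assume h: "h \<noteq> 0 \<and> norm (h - 0) < min d1 d2"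
        show "norm ((G (x + h) - G x) / h - g x) < e"
        proof (cases "0 < h")
          case True
          then show ?thesis using bound[of x "x + h"] h by auto
        next
          case False
          have "(G (x + h) - G x) / h = (G x - G (x + h)) / (x - (x + h))"
            using h by (simp add: field_simps)
          then show ?thesis using False bound[of "x + h" x] h by auto
        qed
      qed (use d1 d2 in auto)
    qed
    then show ?case by (simp add: DERIV_def G_def)
  qed
qed

lemma isCont_set_integral_atMost:
  fixes g :: "real \<Rightarrow> real"
  assumes g: "integrable lborel g"
  shows "isCont (\<lambda>t. LINT x:{..t}|lborel. g x) t"
  unfolding continuous_at_sequentially comp_def
proof (intro allI impI)
  fix X assume X: "X \<longlonglongrightarrow> t"
  have [measurable]: "g \<in> borel_measurable borel" using borel_measurable_integrable[OF g] by simp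
  show "(\<lambda>n. LINT x:{..X n}|lborel. g x) \<longlonglongrightarrow> (LINT x:{..t}|lborel. g x)"
    unfolding set_lebesgue_integral_def
  proof (rule integral_dominated_convergence[where w="\<lambda>x. norm (g x)"])
    show "integrable lborel (\<lambda>x. norm (g x))" using g by simp
    show "AE x in lborel. (\<lambda>n. indicat_real {..X n} x *\<^sub>R g x) \<longlonglongrightarrow> indicat_real {..t} x *\<^sub>R g x"
      using AE_lborel_singleton[of t]
    proof (rule eventually_mono)
      fix x assume elim: "x \<noteq> t"
      have "eventually (\<lambda>n. indicat_real {..X n} x = indicat_real {..t} x) sequentially"
      proof (cases "x < t")
        case True
        then have "eventually (\<lambda>n. x < X n) sequentially" using X order_tendstoD by blast
        then show ?thesis by eventually_elim (use True in \<open>auto simp: indicator_def\<close>)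
      next
        case False
        then have "eventually (\<lambda>n. X n < x) sequentially" using X elim order_tendstoD(2)[of X t _ x] by auto
        then show ?thesis by eventually_elim (use False elim in \<open>auto simp: indicator_def\<close>)
      qed
      then have "eventually (\<lambda>n. indicat_real {..X n} x *\<^sub>R g x = indicat_real {..t} x *\<^sub>R g x) sequentially"
        by eventually_elim simp
      then show "(\<lambda>n. indicat_real {..X n} x *\<^sub>R g x) \<longlonglongrightarrow> indicat_real {..t} x *\<^sub>R g x"
        by (rule tendsto_eventually)
    qed
  qed (auto simp: indicator_def)
qed

text \<open>A Cauchy criterion for the difference quotients that quantifies only over countable types, so that
  measurability can be read off it.  For continuous \<open>F\<close> the quotient is continuous in the increment, and
  rational increments suffice.\<close>

lemma differentiable_iff_rat_Cauchy:
  fixes F :: "real \<Rightarrow> real"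
  assumes cont: "\<And>t. isCont F t"
  defines "dq \<equiv> \<lambda>t h. (F (t + h) - F t) / h"
  shows "F differentiable (at t) \<longleftrightarrow>
    (\<forall>k::nat. \<exists>n::nat. \<forall>a b::rat. of_rat a \<noteq> (0::real) \<longrightarrow> \<bar>of_rat a\<bar> < 1 / real (Suc n) \<longrightarrow>
       of_rat b \<noteq> (0::real) \<longrightarrow> \<bar>of_rat b\<bar> < 1 / real (Suc n) \<longrightarrow>
       \<bar>dq t (of_rat a) - dq t (of_rat b)\<bar> \<le> 1 / real (Suc k))" (is "_ \<longleftrightarrow> ?R")
proof
  assume "F differentiable (at t)"
  then obtain D where "(F has_real_derivative D) (at t)" by (auto simp: real_differentiable_def)
  then have lim: "(dq t \<longlongrightarrow> D) (at 0)" by (simp add: DERIV_def dq_def)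
  show ?R
  proof
    fix k :: nat
    define e where "e = 1 / real (Suc k)"
    have "0 < e / 2" by (simp add: e_def)
    then obtain s where s: "0 < s" "\<And>h. h \<noteq> 0 \<Longrightarrow> \<bar>h\<bar> < s \<Longrightarrow> \<bar>dq t h - D\<bar> < e / 2"
      using LIM_D[OF lim, of "e / 2"] by auto
    obtain n :: nat where n: "1 / real (Suc n) < s" using s(1) nat_approx_posE by blast
    have "\<bar>dq t a - dq t b\<bar> \<le> 1 / real (Suc k)"
      if "a \<noteq> 0" "\<bar>a\<bar> < 1 / real (Suc n)" "b \<noteq> 0" "\<bar>b\<bar> < 1 / real (Suc n)" for a b
    proof -
      have "\<bar>dq t a - D\<bar> < e / 2" "\<bar>dq t b - D\<bar> < e / 2"
        using s(2) that n by auto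
      then show ?thesis unfolding e_def[symmetric] by linarith
    qed
    then show "\<exists>n::nat. \<forall>a b::rat. of_rat a \<noteq> (0::real) \<longrightarrow> \<bar>of_rat a\<bar> < 1 / real (Suc n) \<longrightarrow>
       of_rat b \<noteq> (0::real) \<longrightarrow> \<bar>of_rat b\<bar> < 1 / real (Suc n) \<longrightarrow>
       \<bar>dq t (of_rat a) - dq t (of_rat b)\<bar> \<le> 1 / real (Suc k)" by blast
  qed
next
  assume R: ?R
  have dq_cont: "isCont (dq t) h" if "h \<noteq> 0" for h
  proof -
    have "isCont (\<lambda>h. F (t + h)) h" by (rule isCont_o2[OF _ cont]) (intro continuous_intros)
    then show ?thesis
      unfolding dq_def using that by (intro isCont_divide isCont_diff continuous_const continuous_ident)
  qed
  have rat_seq: "\<exists>r. (\<forall>j. of_rat (r j) \<noteq> (0::real) \<and> \<bar>of_rat (r j)\<bar> < (d::real)) \<and> (\<lambda>j. of_rat (r j)) \<longlonglongrightarrow> h"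
    if h: "h \<noteq> 0" "\<bar>h\<bar> < d" for h d :: real
  proof -
    \<comment> \<open>The radius keeps the rational approximations different from \<open>0\<close> and below \<open>d\<close> in absolute value.\<close>
    define \<eta> where "\<eta> = min \<bar>h\<bar> (d - \<bar>h\<bar>)"
    have "0 < \<eta>" using h by (auto simp: \<eta>_def)
    have "\<exists>q. h < of_rat q \<and> of_rat q < h + \<eta> / real (Suc j)" for j
      using of_rat_dense[of h "h + \<eta> / real (Suc j)"] \<open>0 < \<eta>\<close> by auto
    then obtain r where r: "\<And>j. h < of_rat (r j)" "\<And>j. of_rat (r j) < h + \<eta> / real (Suc j)" by metis
    have "\<eta> / real (Suc j) \<le> \<eta>" for j
      using \<open>0 < \<eta>\<close> by (simp add: divide_le_eq)
    then have r': "\<bar>of_rat (r j) - h\<bar> < \<eta>" for j using r[of j] by (smt (verit, best))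
    have "(\<lambda>j. h + \<eta> * inverse (real (Suc j))) \<longlonglongrightarrow> h + \<eta> * 0"
      by (intro tendsto_intros LIMSEQ_inverse_real_of_nat)
    then have "(\<lambda>j. of_rat (r j)) \<longlonglongrightarrow> h"
      by (intro tendsto_sandwich[of "\<lambda>_. h" "\<lambda>j. of_rat (r j)" sequentially "\<lambda>j. h + \<eta> * inverse (real (Suc j))"])
        (use r in \<open>auto intro!: always_eventually less_imp_le simp: field_simps\<close>)
    moreover have "of_rat (r j) \<noteq> (0::real) \<and> \<bar>of_rat (r j)\<bar> < d" for j
    proof -
      define x where "x = (of_rat (r j) :: real)"
      show ?thesis using r'[of j] unfolding x_def[symmetric] by (auto simp: \<eta>_def)
    qed
    ultimately show ?thesis by blast
  qed
  have real: "\<exists>n::nat. \<forall>a b. a \<noteq> 0 \<longrightarrow> \<bar>a\<bar> < 1 / real (Suc n) \<longrightarrow> b \<noteq> 0 \<longrightarrow> \<bar>b\<bar> < 1 / real (Suc n) \<longrightarrow>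
       \<bar>dq t a - dq t b\<bar> \<le> 1 / real (Suc k)" for k
  proof -
    obtain n :: nat where n: "\<And>a b::rat. of_rat a \<noteq> (0::real) \<Longrightarrow> \<bar>of_rat a\<bar> < 1 / real (Suc n) \<Longrightarrow>
       of_rat b \<noteq> (0::real) \<Longrightarrow> \<bar>of_rat b\<bar> < 1 / real (Suc n) \<Longrightarrow>
       \<bar>dq t (of_rat a) - dq t (of_rat b)\<bar> \<le> 1 / real (Suc k)" using R by blast
    show ?thesis
    proof (intro exI[of _ n] allI impI)
      fix a b :: real assume ab: "a \<noteq> 0" "\<bar>a\<bar> < 1 / real (Suc n)" "b \<noteq> 0" "\<bar>b\<bar> < 1 / real (Suc n)"
      obtain r where r: "\<And>j. of_rat (r j) \<noteq> (0::real)" "\<And>j. \<bar>of_rat (r j)\<bar> < 1 / real (Suc n)"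
        "(\<lambda>j. of_rat (r j)) \<longlonglongrightarrow> a" using rat_seq[OF ab(1,2)] by blast
      obtain s where s: "\<And>j. of_rat (s j) \<noteq> (0::real)" "\<And>j. \<bar>of_rat (s j)\<bar> < 1 / real (Suc n)"
        "(\<lambda>j. of_rat (s j)) \<longlonglongrightarrow> b" using rat_seq[OF ab(3,4)] by blast
      have "(\<lambda>j. \<bar>dq t (of_rat (r j)) - dq t (of_rat (s j))\<bar>) \<longlonglongrightarrow> \<bar>dq t a - dq t b\<bar>"
        using dq_cont[OF ab(1)] dq_cont[OF ab(3)] r(3) s(3)
        by (intro tendsto_intros) (auto intro: isCont_tendsto_compose)
      then show "\<bar>dq t a - dq t b\<bar> \<le> 1 / real (Suc k)"
        by (rule LIMSEQ_le_const2) (use n r s in blast)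
    qed
  qed
  then obtain N where N: "\<And>k a b. a \<noteq> 0 \<Longrightarrow> \<bar>a\<bar> < 1 / real (Suc (N k)) \<Longrightarrow> b \<noteq> 0 \<Longrightarrow>
      \<bar>b\<bar> < 1 / real (Suc (N k)) \<Longrightarrow> \<bar>dq t a - dq t b\<bar> \<le> 1 / real (Suc k)" by metis
  define u where "u j = dq t (1 / real (Suc (Suc j)))" for j
  have u: "\<bar>u j - dq t b\<bar> \<le> 1 / real (Suc k)" if "N k \<le> j" "b \<noteq> 0" "\<bar>b\<bar> < 1 / real (Suc (N k))" for j k b
    unfolding u_def by (rule N) (use that in \<open>auto simp: field_simps\<close>)
  have "Cauchy u"
  proof (rule metric_CauchyI)
    fix e :: real assume "0 < e"
    then obtain k :: nat where k: "1 / real (Suc k) < e" using nat_approx_posE by blast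
    have "dist (u i) (u j) < e" if "N k \<le> i" "N k \<le> j" for i j
    proof -
      have "\<bar>u i - dq t (1 / real (Suc (Suc j)))\<bar> \<le> 1 / real (Suc k)"
        by (rule u) (use that in \<open>auto simp: field_simps\<close>)
      then show ?thesis using k by (simp add: u_def dist_real_def)
    qed
    then show "\<exists>M. \<forall>i\<ge>M. \<forall>j\<ge>M. dist (u i) (u j) < e" by blast
  qed
  then obtain L where L: "u \<longlonglongrightarrow> L" by (auto simp: Cauchy_convergent_iff convergent_def)
  have L': "\<bar>dq t b - L\<bar> \<le> 1 / real (Suc k)" if "b \<noteq> 0" "\<bar>b\<bar> < 1 / real (Suc (N k))" for k b
  proof -
    have "(\<lambda>j. \<bar>u j - dq t b\<bar>) \<longlonglongrightarrow> \<bar>L - dq t b\<bar>" by (intro tendsto_intros L)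
    then have "\<bar>L - dq t b\<bar> \<le> 1 / real (Suc k)"
      by (rule LIMSEQ_le_const2) (use u that in blast)
    then show ?thesis by (simp add: abs_minus_commute)
  qed
  have "(dq t \<longlongrightarrow> L) (at 0)"
  proof (rule LIM_I)
    fix e :: real assume "0 < e"
    then obtain k :: nat where k: "1 / real (Suc k) < e" using nat_approx_posE by blast
    show "\<exists>s>0. \<forall>h::real. h \<noteq> 0 \<and> norm (h - 0) < s \<longrightarrow> norm (dq t h - L) < e"
    proof (intro exI[of _ "1 / real (Suc (N k))"] conjI allI impI)
      fix h :: real assume "h \<noteq> 0 \<and> norm (h - 0) < 1 / real (Suc (N k))"
      then show "norm (dq t h - L) < e" using L'[of h k] k by auto
    qed simp
  qed
  then have "(F has_real_derivative L) (at t)" by (simp add: DERIV_def dq_def)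
  then show "F differentiable (at t)" by (auto simp: real_differentiable_def)
qed

lemma borel_measurable_scaled_deriv:
  fixes F :: "real \<Rightarrow> real"
  assumes cont: "\<And>t. isCont F t"
  shows "scaled_deriv c F \<in> borel_measurable borel"
proof -
  have [measurable]: "F \<in> borel_measurable borel"
    using cont by (intro borel_measurable_continuous_onI continuous_at_imp_continuous_on) auto
  have [measurable]: "Measurable.pred borel (\<lambda>t. F differentiable (at t))"
    unfolding differentiable_iff_rat_Cauchy[OF cont] by measurable
  have "deriv F t = lim (\<lambda>n. (F (t + 1 / real (Suc n)) - F t) / (1 / real (Suc n)))"
    if "F differentiable (at t)" for t
  proof -
    have "(F has_real_derivative deriv F t) (at t)"
      using that DERIV_deriv_iff_real_differentiable by blast
    then have "((\<lambda>h. (F (t + h) - F t) / h) \<longlongrightarrow> deriv F t) (at 0)" by (simp add: DERIV_def)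
    moreover have "filterlim (\<lambda>n. 1 / real (Suc n)) (at 0) sequentially"
      using LIMSEQ_inverse_real_of_nat by (simp add: filterlim_at inverse_eq_divide)
    ultimately have "(\<lambda>n. (F (t + 1 / real (Suc n)) - F t) / (1 / real (Suc n))) \<longlonglongrightarrow> deriv F t"
      by (rule filterlim_compose)
    then show ?thesis by (simp add: limI)
  qed
  then have eq: "scaled_deriv c F = (\<lambda>t. if 0 < t \<and> F differentiable (at t)
      then c * lim (\<lambda>n. (F (t + 1 / real (Suc n)) - F t) / (1 / real (Suc n))) else 0)"
    by (auto simp: scaled_deriv_def fun_eq_iff)
  show ?thesis unfolding eq by measurable
qed

section \<open>Laws of waiting times and their convolutions\<close>

definition waiting_law :: "real measure \<Rightarrow> bool" where
  "waiting_law p \<longleftrightarrow> real_distribution p \<and> absolutely_continuous lborel p \<and> (AE x in p. 0 \<le> x)"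

lemma waiting_lawD:
  assumes "waiting_law p"
  shows "real_distribution p" "prob_space p" "finite_measure p" "sets p = sets borel" "space p = UNIV"
    "absolutely_continuous lborel p" "AE x in p. 0 \<le> x"
  using assms unfolding waiting_law_def real_distribution_def real_distribution_axioms_def prob_space_def
  by (auto dest: sets_eq_imp_space_eq)

lemma AE_convolution:
  assumes "finite_measure \<mu>" "finite_measure \<nu>" and [measurable_cong, simp]: "sets \<mu> = sets borel" "sets \<nu> = sets borel"
    and [measurable]: "Measurable.pred borel P"
  shows "(AE z in \<mu> \<star> \<nu>. P z) \<longleftrightarrow> (AE x in \<mu>. AE y in \<nu>. P (x + y))"
proof -
  interpret \<mu>: finite_measure \<mu> by fact
  interpret \<nu>: finite_measure \<nu> by fact
  interpret pair_sigma_finite \<mu> \<nu> ..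
  have "(AE z in \<mu> \<star> \<nu>. P z) \<longleftrightarrow> (AE z in \<mu> \<Otimes>\<^sub>M \<nu>. P (fst z + snd z))"
    unfolding convolution_def by (subst AE_distr_iff) (auto simp: split_beta')
  also have "\<dots> \<longleftrightarrow> (AE x in \<mu>. AE y in \<nu>. P (x + y))"
  proof (subst AE_pair_iff[symmetric])
    show "{z \<in> space (\<mu> \<Otimes>\<^sub>M \<nu>). P (fst z + snd z)} \<in> sets (\<mu> \<Otimes>\<^sub>M \<nu>)" by measurable
  qed simp
  finally show ?thesis .
qed

lemma AE_nonneg_convolution:
  fixes \<mu> \<nu> :: "real measure"
  assumes fin: "finite_measure \<mu>" "finite_measure \<nu>" and sets: "sets \<mu> = sets borel" "sets \<nu> = sets borel"
    and pos: "AE x in \<mu>. 0 \<le> x" "AE x in \<nu>. 0 \<le> x"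
  shows "AE x in \<mu> \<star> \<nu>. 0 \<le> x"
proof (subst AE_convolution[OF fin sets])
  show "AE x in \<mu>. AE y in \<nu>. 0 \<le> x + y"
    using pos(1) by eventually_elim (use pos(2) in \<open>eventually_elim, auto\<close>)
qed simp

text \<open>By Fubini: \<open>(\<mu> \<star> \<nu>) A\<close> is the \<open>\<mu>\<close>-average of the \<open>\<nu>\<close>-measures of translates of \<open>A\<close>, and translates of
  null sets are null sets.\<close>

lemma absolutely_continuous_convolution:
  fixes \<mu> \<nu> :: "real measure"
  assumes fin: "finite_measure \<mu>" "finite_measure \<nu>" and [simp, measurable_cong]: "sets \<mu> = sets borel" "sets \<nu> = sets borel"
    and ac: "absolutely_continuous lborel \<nu>"
  shows "absolutely_continuous lborel (\<mu> \<star> \<nu>)"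
  unfolding absolutely_continuous_def
proof
  fix A :: "real set" assume A: "A \<in> null_sets lborel"
  then have [measurable]: "A \<in> sets borel" by auto
  have null: "{y. x + y \<in> A} \<in> null_sets \<nu>" for x
  proof -
    have "AE y in lborel. y \<notin> A" using A by (rule AE_not_in)
    then have "AE y in lborel. x + y \<notin> A" 
      by (subst (asm) lborel_distr_plus[of x, symmetric]) (simp add: AE_distr_iff)
    then have "{y. x + y \<in> A} \<in> null_sets lborel"
      using AE_iff_null_sets[of "{y. x + y \<in> A}" lborel] by simp
    then show ?thesis using ac by (auto simp: absolutely_continuous_def)
  qed
  have "emeasure (\<mu> \<star> \<nu>) A = (\<integral>\<^sup>+x. emeasure \<nu> {y. x + y \<in> A} \<partial>\<mu>)"
    using fin by (subst convolution_emeasure) (auto simp: add.commute sets_eq_imp_space_eq[of \<mu> borel] sets_eq_imp_space_eq[of \<nu> borel])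
  also have "\<dots> = 0" using null by (simp add: null_setsD1)
  finally show "A \<in> null_sets (\<mu> \<star> \<nu>)" by (auto simp: null_sets_def)
qed

lemma prob_space_convolution:
  assumes "prob_space \<mu>" "prob_space \<nu>" and [measurable_cong]: "sets \<mu> = sets borel" "sets \<nu> = sets borel"
  shows "prob_space (\<mu> \<star> \<nu>)"
proof -
  interpret \<mu>: prob_space \<mu> by fact
  interpret \<nu>: prob_space \<nu> by fact
  interpret pair_prob_space \<mu> \<nu> ..
  show ?thesis unfolding convolution_def by (intro prob_space_distr) simp
qed

lemma waiting_law_convolution:
  assumes p: "waiting_law p" and m: "waiting_law m"
  shows "waiting_law (p \<star> m)"
proof -
  note p' = waiting_lawD[OF p] and m' = waiting_lawD[OF m]
  have "prob_space (p \<star> m)" using p' m' by (intro prob_space_convolution) auto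
  moreover have "absolutely_continuous lborel (p \<star> m)"
    using p' m' by (intro absolutely_continuous_convolution) auto
  moreover have "AE x in p \<star> m. 0 \<le> x"
    using p' m' by (intro AE_nonneg_convolution) auto
  ultimately show ?thesis
    by (simp add: waiting_law_def real_distribution_def real_distribution_axioms_def)
qed

lemma finite_measure_real_density:
  fixes \<mu> :: "real measure"
  assumes fin: "finite_measure \<mu>" and sets: "sets \<mu> = sets borel" and ac: "absolutely_continuous lborel \<mu>"
  obtains f where "f \<in> borel_measurable borel" "\<And>x. 0 \<le> f x" "integrable lborel f"
    "\<mu> = density lborel (\<lambda>x. ennreal (f x))"
proof -
  interpret finite_measure \<mu> by fact
  define d where "d = RN_deriv lborel \<mu>"
  have [measurable]: "d \<in> borel_measurable borel"
    using borel_measurable_RN_deriv[of lborel \<mu>] by (simp add: d_def)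
  have dens: "density lborel d = \<mu>"
    unfolding d_def by (intro sigma_finite_measure.density_RN_deriv sigma_finite_lborel ac) (simp add: sets)
  have "(\<integral>\<^sup>+x. d x \<partial>lborel) = emeasure \<mu> UNIV"
    unfolding dens[symmetric] by (simp add: emeasure_density)
  then have int: "(\<integral>\<^sup>+x. d x \<partial>lborel) \<noteq> \<infinity>" by (simp add: emeasure_eq_measure)
  then have d_fin: "AE x in lborel. d x = ennreal (enn2real (d x))"
    by (intro eventually_mono[OF nn_integral_PInf_AE[of d lborel]]) (auto simp: less_top)
  show ?thesis
  proof (rule that[of "\<lambda>x. enn2real (d x)"])
    have "density lborel d = density lborel (\<lambda>x. ennreal (enn2real (d x)))"
      using d_fin by (intro density_cong) auto
    then show "\<mu> = density lborel (\<lambda>x. ennreal (enn2real (d x)))" using dens by simp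
    have "(\<integral>\<^sup>+x. ennreal (enn2real (d x)) \<partial>lborel) = (\<integral>\<^sup>+x. d x \<partial>lborel)"
      using d_fin by (intro nn_integral_cong_AE) auto
    then show "integrable lborel (\<lambda>x. enn2real (d x))"
      using int by (intro integrableI_bounded) (auto simp: less_top)
  qed auto
qed

lemma waiting_law_AE_notin_countable:
  assumes q: "waiting_law q" and "countable A"
  shows "AE x in q. x \<notin> A"
proof (rule absolutely_continuous_AE)
  show "sets q = sets lborel" using waiting_lawD(4)[OF q] by simp
  show "absolutely_continuous lborel q" by (rule waiting_lawD(6)[OF q])
  show "AE x in lborel. x \<notin> A" by (intro AE_not_in countable_imp_null_set_lborel assms)
qed

lemma waiting_law_mean_pos:
  assumes q: "waiting_law q" and int: "integrable q (\<lambda>x. x)"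
  shows "0 < (\<integral>x. x \<partial>q)"
proof -
  interpret prob_space q by (rule waiting_lawD[OF q])
  have nn: "AE x in q. 0 \<le> x" by (rule waiting_lawD[OF q])
  have "(\<integral>x. x \<partial>q) \<noteq> 0"
  proof
    assume "(\<integral>x. x \<partial>q) = 0"
    then have "AE x in q. x = 0" using integral_nonneg_eq_0_iff_AE[OF int nn] by simp
    moreover have "AE x in q. x \<notin> {0}" by (rule waiting_law_AE_notin_countable[OF q]) simp
    ultimately have "AE x in q. False" by eventually_elim simp
    then show False by simp
  qed
  moreover have "0 \<le> (\<integral>x. x \<partial>q)" using nn by (rule integral_nonneg_AE)
  ultimately show ?thesis by simp
qed

text \<open>The source of the geometric decay of \<open>P(S\<^sub>n \<le> t)\<close>: a duration is almost surely positive, so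
  \<open>exp (- x)\<close> is almost surely less than \<open>1\<close>.\<close>

lemma exp_moment_less_1:
  assumes "waiting_law q"
  shows "(\<integral>\<^sup>+x. ennreal (exp (- x)) \<partial>q) < 1"
proof -
  note q = waiting_lawD[OF assms]
  interpret prob_space q by fact
  note q(4)[measurable_cong]
  have "AE x in q. x \<notin> {0}" by (rule waiting_law_AE_notin_countable[OF assms]) simp
  with q(7) have pos: "AE x in q. 0 < x" by eventually_elim auto
  have "(\<integral>\<^sup>+x. ennreal (exp (- x)) \<partial>q) \<le> (\<integral>\<^sup>+x. 1 \<partial>q)"
    using pos by (intro nn_integral_mono_AE) (auto elim!: eventually_mono)
  then have le: "(\<integral>\<^sup>+x. ennreal (exp (- x)) \<partial>q) \<le> 1" by (simp add: emeasure_space_1)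
  have "(\<integral>\<^sup>+x. ennreal (exp (- x)) \<partial>q) \<noteq> 1"
  proof
    assume eq: "(\<integral>\<^sup>+x. ennreal (exp (- x)) \<partial>q) = 1"
    have "(\<integral>\<^sup>+x. 1 - ennreal (exp (- x)) \<partial>q) = (\<integral>\<^sup>+x. 1 \<partial>q) - (\<integral>\<^sup>+x. ennreal (exp (- x)) \<partial>q)"
      using eq pos by (intro nn_integral_diff) (auto elim!: eventually_mono)
    then have "(\<integral>\<^sup>+x. 1 - ennreal (exp (- x)) \<partial>q) = 0" using eq by (simp add: emeasure_space_1)
    then have "AE x in q. 1 - ennreal (exp (- x)) = 0" by (subst (asm) nn_integral_0_iff_AE) auto
    with pos have "AE x in q. False"
    proof eventually_elim
      case (elim x)
      then have "1 \<le> ennreal (exp (- x))" by (simp add: diff_eq_0_iff_ennreal)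
      with elim(1) show ?case by simp
    qed
    then show False by simp
  qed
  with le show ?thesis by simp
qed

text \<open>The law of the \<open>n\<close>-th switching epoch when durations with the laws \<open>p\<close> and \<open>m\<close> alternate, starting
  with \<open>p\<close>.\<close>

primrec epoch_law :: "real measure \<Rightarrow> real measure \<Rightarrow> nat \<Rightarrow> real measure" where
  "epoch_law p m 0 = return borel 0"
| "epoch_law p m (Suc n) = (epoch_law p m n \<star> (if even n then p else m))"

lemma return_0_convolution:
  assumes "finite_measure p" and [measurable_cong, simp]: "sets p = sets borel"
  shows "(return borel (0::real) \<star> p) = p"
proof (rule measure_eqI)
  have [simp]: "space p = UNIV" by (simp add: sets_eq_imp_space_eq[of p borel])
  fix A assume "A \<in> sets (return borel (0::real) \<star> p)"
  then have [measurable]: "A \<in> sets borel" by simp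
  have "emeasure (return borel 0 \<star> p) A = (\<integral>\<^sup>+z. indicator A z \<partial>(return borel (0::real) \<star> p))" by simp
  also have "\<dots> = (\<integral>\<^sup>+x. \<integral>\<^sup>+y. indicator A (x + y) \<partial>p \<partial>return borel 0)"
    using assms by (intro nn_integral_convolution) (auto intro!: prob_space_return prob_space.finite_measure)
  also have "\<dots> = emeasure p A"
  proof (subst nn_integral_return)
    interpret finite_measure p by fact
    show "(\<lambda>x::real. \<integral>\<^sup>+y. indicator A (x + y) \<partial>p) \<in> borel_measurable borel" by measurable
  qed auto
  finally show "emeasure (return borel 0 \<star> p) A = emeasure p A" .
qed simp

context
  fixes p m :: "real measure"
  assumes p: "waiting_law p" and m: "waiting_law m"
begin

lemma alternating_law: "waiting_law (if even (n::nat) then p else m)"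
  using p m by simp

lemma epoch_law_prob: "prob_space (epoch_law p m n)" "finite_measure (epoch_law p m n)"
  and epoch_law_sets[simp, measurable_cong]: "sets (epoch_law p m n) = sets borel"
  and epoch_law_AE_nonneg: "AE x in epoch_law p m n. 0 \<le> x"
proof -
  have "prob_space (epoch_law p m n) \<and> sets (epoch_law p m n) = sets borel \<and> (AE x in epoch_law p m n. 0 \<le> x)"
  proof (induction n)
    case 0
    have "AE x in return borel (0::real). 0 \<le> x" by (subst AE_return) auto
    then show ?case unfolding epoch_law.simps by (simp add: prob_space_return)
  next
    case (Suc n)
    have "finite_measure (epoch_law p m n)" using Suc by (auto intro: prob_space.finite_measure)
    note * = Suc this waiting_lawD[OF alternating_law[of n]]
    have "AE x in epoch_law p m (Suc n). 0 \<le> x"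
      unfolding epoch_law.simps using * by (intro AE_nonneg_convolution) auto
    moreover have "prob_space (epoch_law p m (Suc n))"
      unfolding epoch_law.simps using * by (intro prob_space_convolution) auto
    ultimately show ?case by simp
  qed
  then show "prob_space (epoch_law p m n)" "finite_measure (epoch_law p m n)"
    "sets (epoch_law p m n) = sets borel" "AE x in epoch_law p m n. 0 \<le> x"
    by (auto intro: prob_space.finite_measure)
qed

lemma epoch_law_ac: "absolutely_continuous lborel (epoch_law p m (Suc n))"
  using waiting_lawD[OF alternating_law[of n]] epoch_law_prob by (auto intro!: absolutely_continuous_convolution)

lemma epoch_law_1: "epoch_law p m (Suc 0) = p"
  using waiting_lawD[OF p] by (simp add: return_0_convolution)

lemma epoch_law_2: "epoch_law p m (Suc (Suc 0)) = (p \<star> m)"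
  using epoch_law_1 by simp

lemma epoch_law_add2: "epoch_law p m (Suc (Suc n)) = (epoch_law p m n \<star> (p \<star> m))"
proof -
  have "(m \<star> p) = (p \<star> m)"
    using waiting_lawD[OF p] waiting_lawD[OF m] by (intro convolution_commutative) auto
  then show ?thesis
    using waiting_lawD[OF p] waiting_lawD[OF m] epoch_law_prob[of n] by (auto simp: convolution_associative[symmetric])
qed

end

text \<open>Automatic unfolding of the recursion would expose the parity of the index in every later goal.\<close>

declare epoch_law.simps(2)[simp del]

lemma measure_convolution_atMost:
  assumes fin: "finite_measure \<mu>" "finite_measure \<nu>" and [simp, measurable_cong]: "sets \<mu> = sets borel" "sets \<nu> = sets borel"
  shows "measure (\<mu> \<star> \<nu>) {..t::real} = (\<integral>y. measure \<mu> {..t - y} \<partial>\<nu>)"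
    and "integrable \<nu> (\<lambda>y. measure \<mu> {..t - y})"
proof -
  interpret \<mu>: finite_measure \<mu> by fact
  interpret \<nu>: finite_measure \<nu> by fact
  have "(\<lambda>s. measure \<mu> {..s}) \<in> borel_measurable borel"
    by (intro borel_measurable_mono) (auto simp: mono_def intro!: \<mu>.finite_measure_mono)
  then have [measurable]: "(\<lambda>y. measure \<mu> {..t - y}) \<in> borel_measurable borel"
    by (rule measurable_compose[rotated]) simp
  show int: "integrable \<nu> (\<lambda>y. measure \<mu> {..t - y})"
    by (intro \<nu>.integrable_const_bound[of _ "measure \<mu> UNIV"]) (auto intro!: \<mu>.finite_measure_mono)
  have "(\<mu> \<star> \<nu>) = (\<nu> \<star> \<mu>)" using fin by (intro convolution_commutative) auto
  then have "emeasure (\<mu> \<star> \<nu>) {..t} = (\<integral>\<^sup>+z. indicator {..t} z \<partial>(\<nu> \<star> \<mu>))" by simp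
  also have "\<dots> = (\<integral>\<^sup>+y. \<integral>\<^sup>+x. indicator {..t} (y + x) \<partial>\<mu> \<partial>\<nu>)"
    using fin by (intro nn_integral_convolution) auto
  also have "\<dots> = (\<integral>\<^sup>+y. \<integral>\<^sup>+x. indicator {..t - y} x \<partial>\<mu> \<partial>\<nu>)"
    by (intro nn_integral_cong) (auto simp: indicator_def algebra_simps)
  also have "\<dots> = (\<integral>\<^sup>+y. ennreal (measure \<mu> {..t - y}) \<partial>\<nu>)"
    by (simp add: \<mu>.emeasure_eq_measure)
  also have "\<dots> = ennreal (\<integral>y. measure \<mu> {..t - y} \<partial>\<nu>)"
    using int by (intro nn_integral_eq_integral) auto
  finally show "measure (\<mu> \<star> \<nu>) {..t::real} = (\<integral>y. measure \<mu> {..t - y} \<partial>\<nu>)"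
    by (simp add: measure_def integral_nonneg_AE)
qed

section \<open>Characteristic functions\<close>

lemma integrable_iexp_mult:
  assumes "finite_measure \<mu>" "sets \<mu> = sets borel"
  shows "integrable \<mu> (\<lambda>x. iexp (t * x))"
proof -
  have [measurable_cong]: "sets \<mu> = sets borel" by fact
  show ?thesis
    by (rule finite_measure.integrable_const_bound[OF assms(1), where B=1]) auto
qed

lemma char_convolution:
  assumes fin: "finite_measure \<mu>" "finite_measure \<nu>" and [measurable_cong]: "sets \<mu> = sets borel" "sets \<nu> = sets borel"
  shows "char (\<mu> \<star> \<nu>) t = char \<mu> t * char \<nu> t"
proof -
  interpret \<mu>: finite_measure \<mu> by fact
  interpret \<nu>: finite_measure \<nu> by fact
  interpret pair_sigma_finite \<mu> \<nu> ..
  have "finite_measure (\<mu> \<Otimes>\<^sub>M \<nu>)" by (rule finite_measure_pair_measure[OF fin(2,1)])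
  then have int: "integrable (\<mu> \<Otimes>\<^sub>M \<nu>) (\<lambda>z. iexp (t * fst z) * iexp (t * snd z))"
    by (rule finite_measure.integrable_const_bound[where B=1]) (auto simp: norm_mult)
  have "char (\<mu> \<star> \<nu>) t = (\<integral>z. iexp (t * (fst z + snd z)) \<partial>(\<mu> \<Otimes>\<^sub>M \<nu>))"
    unfolding char_def convolution_def by (subst integral_distr) (auto simp: split_beta')
  also have "\<dots> = (\<integral>z. iexp (t * fst z) * iexp (t * snd z) \<partial>(\<mu> \<Otimes>\<^sub>M \<nu>))"
    by (simp add: distrib_left exp_add)
  also have "\<dots> = (\<integral>x. \<integral>y. iexp (t * x) * iexp (t * y) \<partial>\<nu> \<partial>\<mu>)"
    using integral_fst'[OF int] by simp
  also have "\<dots> = char \<mu> t * char \<nu> t"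
    by (simp add: char_def)
  finally show ?thesis .
qed

lemma char_density:
  assumes f: "f \<in> borel_measurable borel" "\<And>x. 0 \<le> f x"
  shows "char (density lborel (\<lambda>x. ennreal (f x))) t = (\<integral>x. f x *\<^sub>R iexp (t * x) \<partial>lborel)"
  unfolding char_def using f by (subst integral_density) auto

text \<open>The renewal equation is an identity between sums of two distribution functions, and subtracting would lead to
  signed measures.  With densities the sum of two measures is the measure with the sum of the densities, and
  measures that agree on all half-lines are equal.\<close>

lemma char_add_cong_cdf:
  assumes fin: "finite_measure A" "finite_measure B" "finite_measure C" "finite_measure D"
    and sets: "sets A = sets borel" "sets B = sets borel" "sets C = sets borel" "sets D = sets borel"
    and ac: "absolutely_continuous lborel A" "absolutely_continuous lborel B"
      "absolutely_continuous lborel C" "absolutely_continuous lborel D"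
    and cdf: "\<And>t. measure A {..t} + measure B {..t} = measure C {..t} + measure D {..t}"
  shows "char A t + char B t = char C t + char D t"
proof -
  have sum: "\<exists>f. f \<in> borel_measurable borel \<and> (\<forall>x. 0 \<le> f x) \<and> (\<forall>t. char (density lborel (\<lambda>x. ennreal (f x))) t = char A t + char B t) \<and>
     (\<forall>t. emeasure (density lborel (\<lambda>x. ennreal (f x))) {..t} = ennreal (measure A {..t} + measure B {..t}))"
    if A: "finite_measure A" "sets A = sets borel" "absolutely_continuous lborel A"
    and B: "finite_measure B" "sets B = sets borel" "absolutely_continuous lborel B" for A B :: "real measure"
  proof -
    obtain f where f[measurable]: "f \<in> borel_measurable borel" and f': "\<And>x. 0 \<le> f x" "integrable lborel f"
      and fA: "A = density lborel (\<lambda>x. ennreal (f x))" using finite_measure_real_density[OF A] by metis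
    obtain g where g[measurable]: "g \<in> borel_measurable borel" and g': "\<And>x. 0 \<le> g x" "integrable lborel g"
      and gB: "B = density lborel (\<lambda>x. ennreal (g x))" using finite_measure_real_density[OF B] by metis
    have int: "integrable lborel (\<lambda>x. h x *\<^sub>R iexp (t * x))" if [measurable]: "h \<in> borel_measurable borel" "integrable lborel h"
      for h :: "real \<Rightarrow> real" and t
      by (rule Bochner_Integration.integrable_bound[OF that(2)]) auto
    have "char (density lborel (\<lambda>x. ennreal (f x + g x))) t = char A t + char B t" for t
    proof -
      have "char (density lborel (\<lambda>x. ennreal (f x + g x))) t = (\<integral>x. (f x + g x) *\<^sub>R iexp (t * x) \<partial>lborel)"
        using f'(1) g'(1) by (intro char_density) auto
      also have "\<dots> = (\<integral>x. f x *\<^sub>R iexp (t * x) \<partial>lborel) + (\<integral>x. g x *\<^sub>R iexp (t * x) \<partial>lborel)"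
        unfolding scaleR_add_left by (intro Bochner_Integration.integral_add int f g f'(2) g'(2))
      finally show ?thesis unfolding fA gB char_density[OF f f'(1)] char_density[OF g g'(1)] .
    qed
    moreover have "emeasure (density lborel (\<lambda>x. ennreal (f x + g x))) {..t} = ennreal (measure A {..t} + measure B {..t})" for t
    proof -
      have "emeasure (density lborel (\<lambda>x. ennreal (f x + g x))) {..t} = emeasure A {..t} + emeasure B {..t}"
        unfolding fA gB using f'(1) g'(1) by (simp add: emeasure_density nn_integral_add[symmetric] distrib_right)
      then show ?thesis
        using A(1) B(1) by (simp add: finite_measure.emeasure_eq_measure)
    qed
    ultimately show ?thesis using f g f' g' by (intro exI[of _ "\<lambda>x. f x + g x"]) auto
  qed
  obtain f where f: "f \<in> borel_measurable borel"
      "\<And>t. char (density lborel (\<lambda>x. ennreal (f x))) t = char A t + char B t"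
      "\<And>t. emeasure (density lborel (\<lambda>x. ennreal (f x))) {..t} = ennreal (measure A {..t} + measure B {..t})"
    using sum[of A B] fin sets ac by metis
  obtain g where g: "g \<in> borel_measurable borel"
      "\<And>t. char (density lborel (\<lambda>x. ennreal (g x))) t = char C t + char D t"
      "\<And>t. emeasure (density lborel (\<lambda>x. ennreal (g x))) {..t} = ennreal (measure C {..t} + measure D {..t})"
    using sum[of C D] fin sets ac by metis
  have "density lborel (\<lambda>x. ennreal (f x)) = density lborel (\<lambda>x. ennreal (g x))"
  proof (rule measure_eqI_generator_eq[where E="range atMost" and \<Omega>=UNIV and A="\<lambda>i. {..real i}"])
    show "Int_stable (range atMost :: real set set)" by (auto simp: Int_stable_def)
    show "sets (density lborel (\<lambda>x. ennreal (f x))) = sigma_sets UNIV (range atMost)"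
      "sets (density lborel (\<lambda>x. ennreal (g x))) = sigma_sets UNIV (range atMost)"
      by (simp_all add: borel_eq_atMost)
    show "(\<Union>i. {..real i}) = UNIV" using real_arch_simple by auto
  qed (auto simp: f g cdf)
  then show ?thesis using f(2) g(2) by metis
qed

text \<open>The value \<open>1\<close> would force \<open>cos (t x) = 1\<close> almost surely, hence concentrate the law on the lattice
  \<open>2 \<pi> \<int> / t\<close>, a null set.\<close>

lemma waiting_law_char_neq_1:
  assumes q: "waiting_law q" and t: "t \<noteq> 0"
  shows "char q t \<noteq> 1"
proof
  assume 1: "char q t = 1"
  note w = waiting_lawD[OF q]
  interpret prob_space q by (rule w)
  note w(4)[measurable_cong]
  have int: "integrable q (\<lambda>x. cos (t * x))"
    by (rule integrable_const_bound[where B=1]) auto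
  have "Re (char q t) = (\<integral>x. cos (t * x) \<partial>q)"
    unfolding char_def using integrable_iexp_mult[OF w(3,4), of t] by (subst integral_Re[symmetric]) (auto simp: Re_exp)
  then have "(\<integral>x. 1 - cos (t * x) \<partial>q) = 0"
    using 1 int by (simp add: prob_space)
  then have "AE x in q. 1 - cos (t * x) = 0"
    using int by (subst (asm) integral_nonneg_eq_0_iff_AE) auto
  moreover have "AE x in q. x \<notin> range (\<lambda>k::int. of_int k * 2 * pi / t)"
    by (intro waiting_law_AE_notin_countable[OF q]) simp
  ultimately have "AE x in q. False"
  proof eventually_elim
    case (elim x)
    then obtain k :: int where "t * x = of_int k * 2 * pi" by (auto simp: cos_one_2pi_int)
    then have "x = of_int k * 2 * pi / t" using t by (simp add: field_simps)
    with elim(2) show ?case by blast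
  qed
  then show False by simp
qed

text \<open>The derivative of the characteristic function at \<open>0\<close>, taken along the sequence \<open>1 / (n + 1)\<close> so that
  dominated convergence applies directly.\<close>

lemma char_difference_quotient:
  assumes fin: "finite_measure \<mu>" and [measurable_cong]: "sets \<mu> = sets borel" and int: "integrable \<mu> (\<lambda>x. x)"
  shows "(\<lambda>n. (char \<mu> (1 / real (Suc n)) - char \<mu> 0) * of_real (real (Suc n))) \<longlonglongrightarrow> \<i> * of_real (\<integral>x. x \<partial>\<mu>)"
proof -
  \<comment> \<open>Second-order Taylor bound; it gives the pointwise limit but grows too fast in \<open>x\<close> to dominate.
    The integrable bound \<open>\<bar>x\<bar>\<close> comes from the first-order estimate.\<close>
  have bound: "norm ((iexp (h * x) - 1) / of_real h - \<i> * of_real x) \<le> h * x\<^sup>2 / 2" if "0 < h" for h x :: real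
  proof -
    have "norm (iexp (h * x) - (1 + \<i> * of_real (h * x))) \<le> \<bar>h * x\<bar>\<^sup>2 / 2"
      using iexp_approx1[of "h * x" 1] by (simp add: numeral_2_eq_2)
    then have "norm (iexp (h * x) - (1 + \<i> * of_real (h * x))) / h \<le> (h * x)\<^sup>2 / 2 / h"
      using that by (intro divide_right_mono) auto
    moreover have "(iexp (h * x) - 1) / of_real h - \<i> * of_real x = (iexp (h * x) - (1 + \<i> * of_real (h * x))) / of_real h"
      using that by (simp add: field_simps)
    moreover have "(h * x)\<^sup>2 / 2 / h = h * x\<^sup>2 / 2"
      using that by (simp add: power2_eq_square)
    moreover have "norm (of_real h :: complex) = h" using that by simp
    ultimately show ?thesis by (simp only: norm_divide)
  qed
  have "(\<lambda>n. \<integral>x. (iexp (1 / real (Suc n) * x) - 1) * of_real (real (Suc n)) \<partial>\<mu>) \<longlonglongrightarrow> (\<integral>x. \<i> * of_real x \<partial>\<mu>)"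
  proof (rule integral_dominated_convergence[where w="\<lambda>x. \<bar>x\<bar>"])
    show "integrable \<mu> (\<lambda>x. \<bar>x\<bar>)" using int by simp
    show "AE x in \<mu>. (\<lambda>n. (iexp (1 / real (Suc n) * x) - 1) * of_real (real (Suc n))) \<longlonglongrightarrow> \<i> * of_real x"
    proof (rule AE_I2)
      fix x :: real
      have "(\<lambda>n. inverse (real (Suc n)) * (x\<^sup>2 / 2)) \<longlonglongrightarrow> 0 * (x\<^sup>2 / 2)"
        by (intro tendsto_mult tendsto_const LIMSEQ_inverse_real_of_nat)
      then have lim: "(\<lambda>n. inverse (real (Suc n)) * (x\<^sup>2 / 2)) \<longlonglongrightarrow> 0" by (simp only: mult_zero_left)
      have le: "norm ((iexp (1 / real (Suc n) * x) - 1) * of_real (real (Suc n)) - \<i> * of_real x)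
           \<le> inverse (real (Suc n)) * (x\<^sup>2 / 2)" for n
      proof -
        have "(iexp (1 / real (Suc n) * x) - 1) / of_real (1 / real (Suc n)) =
            (iexp (1 / real (Suc n) * x) - 1) * of_real (real (Suc n))"
          by (simp add: divide_simps)
        then show ?thesis using bound[of "1 / real (Suc n)" x] by (simp add: inverse_eq_divide)
      qed
      have "(\<lambda>n. (iexp (1 / real (Suc n) * x) - 1) * of_real (real (Suc n)) - \<i> * of_real x) \<longlonglongrightarrow> 0"
        by (rule Lim_null_comparison[OF always_eventually[OF allI[OF le]] lim])
      then show "(\<lambda>n. (iexp (1 / real (Suc n) * x) - 1) * of_real (real (Suc n))) \<longlonglongrightarrow> \<i> * of_real x"
        by (rule LIM_zero_cancel)
    qed
    fix n
    show "AE x in \<mu>. norm ((iexp (1 / real (Suc n) * x) - 1) * of_real (real (Suc n))) \<le> \<bar>x\<bar>"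
    proof (rule AE_I2)
      fix x :: real
      have "norm (iexp (1 / real (Suc n) * x) - 1) * real (Suc n) \<le> \<bar>1 / real (Suc n) * x\<bar> * real (Suc n)"
        using iexp_approx1[of "1 / real (Suc n) * x" 0] by (intro mult_right_mono) auto
      then show "norm ((iexp (1 / real (Suc n) * x) - 1) * of_real (real (Suc n))) \<le> \<bar>x\<bar>"
        by (simp add: norm_mult abs_mult del: of_nat_Suc)
    qed
  qed auto
  moreover have "(\<integral>x. (iexp (1 / real (Suc n) * x) - 1) * of_real (real (Suc n)) \<partial>\<mu>) =
      (char \<mu> (1 / real (Suc n)) - char \<mu> 0) * of_real (real (Suc n))" for n
    using integrable_iexp_mult[OF assms(1,2), of "1 / real (Suc n)"] integrable_iexp_mult[OF assms(1,2), of 0]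
    by (simp add: char_def del: of_nat_Suc)
  ultimately show ?thesis by (simp del: of_nat_Suc)
qed

lemma char_tendsto_0:
  assumes fin: "finite_measure \<mu>" and [measurable_cong]: "sets \<mu> = sets borel"
  shows "(\<lambda>n. char \<mu> (1 / real (Suc n))) \<longlonglongrightarrow> of_real (measure \<mu> UNIV)"
proof -
  interpret finite_measure \<mu> by fact
  have sp: "space \<mu> = UNIV" using sets_eq_imp_space_eq[OF assms(2)] by simp
  have "(\<lambda>n. char \<mu> (1 / real (Suc n))) \<longlonglongrightarrow> (\<integral>x. 1 \<partial>\<mu>)"
    unfolding char_def
  proof (rule integral_dominated_convergence[where w="\<lambda>x. 1"])
    show "AE x in \<mu>. (\<lambda>n. iexp (1 / real (Suc n) * x)) \<longlonglongrightarrow> 1"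
    proof (rule AE_I2)
      fix x :: real
      have "(\<lambda>n. iexp (inverse (real (Suc n)) * x)) \<longlonglongrightarrow> iexp (0 * x)"
        by (intro isCont_tendsto_compose[OF isCont_iexp] tendsto_intros LIMSEQ_inverse_real_of_nat)
      then show "(\<lambda>n. iexp (1 / real (Suc n) * x)) \<longlonglongrightarrow> 1" by (simp add: inverse_eq_divide)
    qed
  qed auto
  then show ?thesis by (simp add: sp scaleR_conv_of_real)
qed

section \<open>The alternating renewal function\<close>

text \<open>In terms of the switch process, \<open>renewal_cdf p m t\<close> is the probability of being at time \<open>t\<close> in the state
  opposite to the initial one: odd switches lead into that state, even switches out of it.\<close>

definition renewal_cdf :: "real measure \<Rightarrow> real measure \<Rightarrow> real \<Rightarrow> real" where
  "renewal_cdf p m t = (\<Sum>n. (-1) ^ n * measure (epoch_law p m (Suc n)) {..t})"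

abbreviation renewal_density :: "real measure \<Rightarrow> real measure \<Rightarrow> real \<Rightarrow> real" where
  "renewal_density p m \<equiv> scaled_deriv 1 (renewal_cdf p m)"

context
  fixes p m :: "real measure"
  assumes p: "waiting_law p" and m: "waiting_law m"
begin

text \<open>Chernoff's bound \<open>P(S \<le> t) \<le> exp t * E (exp (- S))\<close>, where the exponential moment is multiplicative over
  the independent durations.\<close>

lemma epoch_law_exp_bound:
  obtains c where "0 \<le> c" "c < 1" "\<And>n t. measure (epoch_law p m n) {..t} \<le> exp t * c ^ n"
proof -
  define L where "L q = (\<integral>\<^sup>+x. ennreal (exp (- x)) \<partial>q)" for q :: "real measure"
  define c where "c = max (enn2real (L p)) (enn2real (L m))"
  have L1: "L p < 1" "L m < 1" using exp_moment_less_1 p m by (auto simp: L_def)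
  then obtain a b where ab: "L p = ennreal a" "L m = ennreal b" "0 \<le> a" "0 \<le> b"
    by (metis ennreal_cases ennreal_one_less_top less_trans less_irrefl infinity_ennreal_def)
  then have c: "0 \<le> c" "c < 1" using L1 by (auto simp: c_def le_max_iff_disj)
  have Lc: "L (if even n then p else m) \<le> ennreal c" for n :: nat
    using ab by (auto simp: c_def intro!: ennreal_leI)
  have L_epoch: "L (epoch_law p m n) \<le> ennreal (c ^ n)" for n
  proof (induction n)
    case 0
    show ?case by (simp add: L_def nn_integral_return)
  next
    case (Suc n)
    let ?q = "if even n then p else m"
    note q = waiting_lawD[OF alternating_law[OF p m, of n]] and e = epoch_law_prob[OF p m, of n] epoch_law_sets[OF p m, of n]
    have [measurable_cong]: "sets ?q = sets borel" by (rule q(4))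
    have "L (epoch_law p m (Suc n)) = (\<integral>\<^sup>+x. \<integral>\<^sup>+y. ennreal (exp (- (x + y))) \<partial>?q \<partial>epoch_law p m n)"
      using q e by (simp only: L_def epoch_law.simps) (subst nn_integral_convolution, auto)
    also have "\<dots> = (\<integral>\<^sup>+x. ennreal (exp (- x)) * L ?q \<partial>epoch_law p m n)"
      unfolding L_def
      by (intro nn_integral_cong) (subst nn_integral_cmult[symmetric], auto simp: ennreal_mult[symmetric] simp flip: exp_add)
    also have "\<dots> = L (epoch_law p m n) * L ?q"
      unfolding L_def using e by (subst nn_integral_multc) (auto simp: measurable_cong_sets[OF e(3) refl])
    also have "\<dots> \<le> ennreal (c ^ n) * ennreal c"
      using Suc Lc by (intro mult_mono) auto
    finally show ?case using c by (simp add: ennreal_mult[symmetric] mult.commute)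
  qed
  have "measure (epoch_law p m n) {..t} \<le> exp t * c ^ n" for n t
  proof -
    interpret E: prob_space "epoch_law p m n" by (rule epoch_law_prob[OF p m])
    note epoch_law_sets[OF p m, measurable_cong]
    have "emeasure (epoch_law p m n) {..t} = (\<integral>\<^sup>+x. indicator {..t} x \<partial>epoch_law p m n)"
      by (simp add: epoch_law_sets[OF p m])
    also have "\<dots> \<le> (\<integral>\<^sup>+x. ennreal (exp t) * ennreal (exp (- x)) \<partial>epoch_law p m n)"
      by (intro nn_integral_mono) (auto simp: indicator_def ennreal_mult[symmetric] exp_minus field_simps)
    also have "\<dots> = ennreal (exp t) * L (epoch_law p m n)"
      unfolding L_def by (subst nn_integral_cmult) auto
    also have "\<dots> \<le> ennreal (exp t) * ennreal (c ^ n)"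
      using L_epoch by (intro mult_mono) auto
    finally show ?thesis using c by (simp add: ennreal_mult[symmetric] E.emeasure_eq_measure)
  qed
  with c show ?thesis by (rule that)
qed

lemma summable_epoch_cdf: "summable (\<lambda>n. measure (epoch_law p m n) {..t})"
proof -
  obtain c where c: "0 \<le> c" "c < 1" "\<And>n t. measure (epoch_law p m n) {..t} \<le> exp t * c ^ n"
    using epoch_law_exp_bound by metis
  show ?thesis
  proof (rule summable_comparison_test')
    show "summable (\<lambda>n. exp t * c ^ n)" using c by (intro summable_mult summable_geometric) simp
    show "norm (measure (epoch_law p m n) {..t}) \<le> exp t * c ^ n" for n using c(3) by simp
  qed
qed

lemma summable_epoch_cdf_shift: "summable (\<lambda>n. measure (epoch_law p m (n + k)) {..t})"
  using summable_epoch_cdf[of t] by (rule summable_ignore_initial_segment)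

lemma summable_renewal_cdf: "summable (\<lambda>n. (-1) ^ n * measure (epoch_law p m (Suc n)) {..t})"
proof -
  have "summable (\<lambda>n. measure (epoch_law p m (Suc n)) {..t})"
    using summable_epoch_cdf_shift[of 1 t] by simp
  then show ?thesis by (intro summable_norm_cancel[of "\<lambda>n. (-1) ^ n * measure (epoch_law p m (Suc n)) {..t}"]) (simp add: abs_mult)
qed

text \<open>Convolution with the cycle law \<open>p \<star> m\<close> moves every term of the alternating series two places ahead, so
  it reproduces the series without its first two terms.  These are the distribution functions of \<open>p\<close>
  and \<open>p \<star> m\<close>.\<close>

lemma renewal_equation:
  "renewal_cdf p m t + measure (p \<star> m) {..t} = measure p {..t} + (\<integral>y. renewal_cdf p m (t - y) \<partial>(p \<star> m))"
proof -
  let ?F = "\<lambda>n t. measure (epoch_law p m n) {..t}"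
  note f = waiting_lawD[OF waiting_law_convolution[OF p m]]
  note conv = measure_convolution_atMost[OF epoch_law_prob(2)[OF p m] f(3) epoch_law_sets[OF p m] f(4)]
  have F2: "?F (Suc (Suc n)) t = (\<integral>y. ?F n (t - y) \<partial>(p \<star> m))" for n
    unfolding epoch_law_add2[OF p m] by (rule conv)
  have "(\<integral>y. renewal_cdf p m (t - y) \<partial>(p \<star> m)) = (\<Sum>n. \<integral>y. (-1) ^ n * ?F (Suc n) (t - y) \<partial>(p \<star> m))"
    unfolding renewal_cdf_def
  proof (rule integral_suminf)
    show "integrable (p \<star> m) (\<lambda>y. (-1) ^ n * ?F (Suc n) (t - y))" for n
      by (intro integrable_mult_right conv)
    show "AE y in p \<star> m. summable (\<lambda>n. norm ((-1) ^ n * ?F (Suc n) (t - y)))"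
      using summable_epoch_cdf_shift[where k=1] by (simp add: abs_mult)
    show "summable (\<lambda>n. \<integral>y. norm ((-1) ^ n * ?F (Suc n) (t - y)) \<partial>(p \<star> m))"
      using summable_epoch_cdf_shift[of 3 t] by (simp add: abs_mult F2[symmetric] numeral_3_eq_3)
  qed
  also have "\<dots> = (\<Sum>n. (-1) ^ n * ?F (Suc (Suc (Suc n))) t)"
    by (simp add: F2)
  also have "\<dots> = renewal_cdf p m t - (?F 1 t - ?F 2 t)"
    unfolding renewal_cdf_def using suminf_minus_initial_segment[OF summable_renewal_cdf, of 2 t]
    by (simp add: numeral_2_eq_2)
  finally show ?thesis
    by (simp add: epoch_law_1[OF p m] epoch_law_2[OF p m] numeral_2_eq_2)
qed

lemma renewal_cdf_nonpos: "t \<le> 0 \<Longrightarrow> renewal_cdf p m t = 0"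
proof -
  assume t: "t \<le> 0"
  have "measure (epoch_law p m (Suc n)) {..t} = 0" for n
  proof -
    interpret E: prob_space "epoch_law p m (Suc n)" by (rule epoch_law_prob[OF p m])
    have "AE x in epoch_law p m (Suc n). x \<noteq> 0"
      by (rule absolutely_continuous_AE[OF _ epoch_law_ac[OF p m] AE_lborel_singleton])
        (simp add: epoch_law_sets[OF p m])
    with epoch_law_AE_nonneg[OF p m, of "Suc n"] have "AE x in epoch_law p m (Suc n). x \<notin> {..t}"
      by eventually_elim (use t in auto)
    then have "emeasure (epoch_law p m (Suc n)) {x \<in> space (epoch_law p m (Suc n)). x \<in> {..t}} = 0"
      by (rule emeasure_eq_0_AE)
    then show ?thesis
      by (simp add: measure_def sets_eq_imp_space_eq[OF epoch_law_sets[OF p m]] lessThan_def atMost_def)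
  qed
  then show ?thesis by (simp add: renewal_cdf_def)
qed

text \<open>On a half-line \<open>{..K}\<close> the densities of all epochs are summable in the mean, since their integrals
  \<open>P(S\<^sub>n \<le> K)\<close> decay geometrically; their alternating sum is the density.  It need not be integrable over
  the whole line, hence the bound \<open>K\<close>.\<close>

lemma renewal_cdf_local_density:
  obtains g where "integrable lborel g"
    "\<And>t. t \<le> K \<Longrightarrow> renewal_cdf p m t = (LINT x:{..t}|lborel. g x)"
proof -
  have "\<exists>f. f \<in> borel_measurable borel \<and> (\<forall>x. 0 \<le> f x) \<and>
      epoch_law p m (Suc n) = density lborel (\<lambda>x. ennreal (f x))" for n
    using finite_measure_real_density[OF epoch_law_prob(2)[OF p m] epoch_law_sets[OF p m] epoch_law_ac[OF p m]] by metis
  then obtain f where [measurable]: "\<And>n. f n \<in> borel_measurable borel" and f0: "\<And>n x. 0 \<le> f n x"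
    and dens: "\<And>n. epoch_law p m (Suc n) = density lborel (\<lambda>x. ennreal (f n x))" by metis
  define e where "e n x = indicator {..K} x * f n x" for n x
  have [measurable]: "e n \<in> borel_measurable borel" for n unfolding e_def by measurable
  have e_int: "(\<integral>\<^sup>+x. ennreal (indicator {..t} x * e n x) \<partial>lborel) = ennreal (measure (epoch_law p m (Suc n)) {..t})" if "t \<le> K" for n t
  proof -
    interpret E: prob_space "epoch_law p m (Suc n)" by (rule epoch_law_prob[OF p m])
    have "(\<integral>\<^sup>+x. ennreal (indicator {..t} x * e n x) \<partial>lborel) = emeasure (epoch_law p m (Suc n)) {..t}"
      unfolding dens using that by (simp add: emeasure_density) (intro nn_integral_cong, auto simp: e_def indicator_def)
    then show ?thesis by (simp add: E.emeasure_eq_measure)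
  qed
  have e0: "0 \<le> e n x" for n x using f0 by (simp add: e_def)
  have e_bint: "has_bochner_integral lborel (\<lambda>x. indicator {..t} x * e n x) (measure (epoch_law p m (Suc n)) {..t})"
    if "t \<le> K" for n t
    using e_int[OF that, of n] e0 by (intro has_bochner_integral_nn_integral) auto
  have eK: "indicator {..K} x * e n x = e n x" for n x by (auto simp: e_def indicator_def)
  have sumF: "summable (\<lambda>n. measure (epoch_law p m (Suc n)) {..t})" for t
    using summable_epoch_cdf_shift[of 1 t] by simp
  have "(\<integral>\<^sup>+x. (\<Sum>n. ennreal (e n x)) \<partial>lborel) = (\<Sum>n. ennreal (measure (epoch_law p m (Suc n)) {..K}))"
    using e_int[of K, unfolded eK] by (subst nn_integral_suminf) simp_all
  also have "\<dots> < \<infinity>"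
    using sumF[of K] by (simp add: suminf_ennreal2)
  finally have "AE x in lborel. (\<Sum>n. ennreal (e n x)) \<noteq> \<infinity>"
    by (intro nn_integral_PInf_AE) auto
  then have sum_e: "AE x in lborel. summable (\<lambda>n. e n x)"
    by eventually_elim (auto intro!: summable_suminf_not_top e0)
  define g where "g x = (\<Sum>n. (-1) ^ n * e n x)" for x
  have *: "integrable lborel (\<lambda>x. (\<Sum>n. (-1) ^ n * (indicator {..t} x * e n x)))"
     "(\<integral>x. (\<Sum>n. (-1) ^ n * (indicator {..t} x * e n x)) \<partial>lborel) = renewal_cdf p m t"
    if "t \<le> K" for t
  proof -
    have 1: "integrable lborel (\<lambda>x. (-1) ^ n * (indicator {..t} x * e n x))" for n
      using e_bint[OF that, of n] by (intro integrable_mult_right) (auto simp: has_bochner_integral_iff)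
    have 2: "AE x in lborel. summable (\<lambda>n. norm ((-1) ^ n * (indicator {..t} x * e n x)))"
      using sum_e by eventually_elim (auto simp: abs_mult e0 indicator_def)
    have 3: "summable (\<lambda>n. \<integral>x. norm ((-1) ^ n * (indicator {..t} x * e n x)) \<partial>lborel)"
      using sumF[of t] e_bint[OF that] by (simp add: abs_mult e0 has_bochner_integral_iff)
    show "integrable lborel (\<lambda>x. (\<Sum>n. (-1) ^ n * (indicator {..t} x * e n x)))"
      by (rule integrable_suminf[OF 1 2 3])
    show "(\<integral>x. (\<Sum>n. (-1) ^ n * (indicator {..t} x * e n x)) \<partial>lborel) = renewal_cdf p m t"
      using e_bint[OF that] by (subst integral_suminf[OF 1 2 3]) (simp add: renewal_cdf_def has_bochner_integral_iff)
  qed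
  have "integrable lborel g" using *(1)[of K] by (simp add: eK g_def[abs_def])
  moreover have "renewal_cdf p m t = (LINT x:{..t}|lborel. g x)" if "t \<le> K" for t
  proof -
    have "(\<Sum>n. (-1) ^ n * (indicator {..t} x * e n x)) = indicator {..t} x * g x" for x
      by (cases "x \<le> t") (auto simp: g_def)
    then show ?thesis using *(2)[OF that] by (simp add: set_lebesgue_integral_def)
  qed
  ultimately show ?thesis by (rule that)
qed

lemma renewal_cdf_isCont: "isCont (renewal_cdf p m) t"
proof -
  obtain g where g: "integrable lborel g" "\<And>s. s \<le> t + 1 \<Longrightarrow> renewal_cdf p m s = (LINT x:{..s}|lborel. g x)"
    using renewal_cdf_local_density by metis
  have "isCont (\<lambda>s. LINT x:{..s}|lborel. g x) t" by (rule isCont_set_integral_atMost[OF g(1)])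
  moreover have "eventually (\<lambda>s. s < t + 1) (nhds t)" by (rule eventually_nhds_in_open[of "{..<t+1}", simplified]) auto
  then have "eventually (\<lambda>s. renewal_cdf p m s = (LINT x:{..s}|lborel. g x)) (nhds t)"
    by eventually_elim (simp add: g(2))
  ultimately show ?thesis by (simp add: isCont_cong)
qed

text \<open>The local densities above are almost everywhere the derivative, by Lebesgue's differentiation theorem.  The
  function \<open>scaled_deriv 1\<close> is \<open>0\<close> on the negative half-line, which is consistent because the distribution
  function vanishes there.\<close>

lemma renewal_cdf_eq_integral:
  shows "set_integrable lborel {..t} (renewal_density p m)" "renewal_cdf p m t = (LINT x:{..t}|lborel. renewal_density p m x)"
proof -
  obtain g where g: "integrable lborel g" "\<And>s. s \<le> t + 1 \<Longrightarrow> renewal_cdf p m s = (LINT x:{..s}|lborel. g x)"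
    using renewal_cdf_local_density by metis
  have [measurable]: "g \<in> borel_measurable borel" using borel_measurable_integrable[OF g(1)] by simp
  have [measurable]: "renewal_density p m \<in> borel_measurable borel"
    by (rule borel_measurable_scaled_deriv[OF renewal_cdf_isCont])
  have ae: "AE x in lborel. x < t + 1 \<longrightarrow> (renewal_cdf p m has_real_derivative g x) (at x)"
    using AE_deriv_integral[OF g(1)]
  proof (rule eventually_mono, intro impI)
    fix x assume x: "((\<lambda>t. LINT y:{..t}|lborel. g y) has_real_derivative g x) (at x)" "x < t + 1"
    show "(renewal_cdf p m has_real_derivative g x) (at x)"
      using x by (intro has_field_derivative_transform_within_open[OF x(1), of "{..<t+1}"]) (auto simp: g(2))
  qed
  have *: "AE x in lborel. indicator {..t} x *\<^sub>R renewal_density p m x = indicator {..t} x *\<^sub>R g x"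
    using ae AE_lborel_singleton[of 0]
  proof (rule eventually_elim2)
    fix x assume x: "x < t + 1 \<longrightarrow> (renewal_cdf p m has_real_derivative g x) (at x)" "x \<noteq> 0"
    show "indicator {..t} x *\<^sub>R renewal_density p m x = indicator {..t} x *\<^sub>R g x"
    proof (cases "x \<le> t")
      case True
      with x have D: "(renewal_cdf p m has_real_derivative g x) (at x)" by simp
      show ?thesis
      proof (cases "0 < x")
        case True
        then show ?thesis
          using D by (auto simp: scaled_deriv_def real_differentiable_def DERIV_imp_deriv)
      next
        case False
        then have "x < 0" using x by simp
        have "((\<lambda>_. 0) has_real_derivative g x) (at x)"
          using \<open>x < 0\<close> by (intro has_field_derivative_transform_within_open[OF D, of "{..<0}"]) (auto simp: renewal_cdf_nonpos)
        then have "g x = 0" using DERIV_unique DERIV_const by blast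
        then show ?thesis using False by (simp add: scaled_deriv_def)
      qed
    qed simp
  qed
  have "set_integrable lborel {..t} g"
    unfolding set_integrable_def using g(1) by (intro integrable_mult_indicator) auto
  then show "set_integrable lborel {..t} (renewal_density p m)"
    unfolding set_integrable_def using * by (subst integrable_cong_AE) auto
  show "renewal_cdf p m t = (LINT x:{..t}|lborel. renewal_density p m x)"
    unfolding g(2)[of t, simplified] set_lebesgue_integral_def using * by (intro integral_cong_AE[symmetric]) auto
qed

end

definition renewal_measure :: "real measure \<Rightarrow> real measure \<Rightarrow> real measure" where
  "renewal_measure p m = density lborel (\<lambda>x. ennreal (renewal_density p m x))"

lemma sets_renewal_measure: "sets (renewal_measure p m) = sets borel"
  by (simp add: renewal_measure_def)

context
  fixes p m :: "real measure"
  assumes p: "waiting_law p" and m: "waiting_law m"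
begin

lemma epoch_cdf_antimono: "measure (epoch_law p m (Suc n)) {..t} \<le> measure (epoch_law p m n) {..t}"
proof -
  let ?q = "if even n then p else m"
  note q = waiting_lawD[OF alternating_law[OF p m, of n]]
  note conv = measure_convolution_atMost[OF epoch_law_prob(2)[OF p m] q(3) epoch_law_sets[OF p m] q(4)]
  interpret E: prob_space "epoch_law p m n" by (rule epoch_law_prob[OF p m])
  interpret q: prob_space ?q by (rule q)
  have "measure (epoch_law p m (Suc n)) {..t} = (\<integral>y. measure (epoch_law p m n) {..t - y} \<partial>?q)"
    unfolding epoch_law.simps(2) by (rule conv)
  also have "\<dots> \<le> (\<integral>y. measure (epoch_law p m n) {..t} \<partial>?q)"
  proof (rule integral_mono_AE)
    show "AE y in ?q. measure (epoch_law p m n) {..t - y} \<le> measure (epoch_law p m n) {..t}"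
      using q(7) by (rule eventually_mono) (auto intro!: E.finite_measure_mono simp: epoch_law_sets[OF p m])
    show "integrable ?q (\<lambda>y. measure (epoch_law p m n) {..t - y})" by (rule conv(2))
  qed simp
  finally show ?thesis by (simp add: q.prob_space)
qed

text \<open>The terms \<open>P(S\<^sub>n\<^sub>+\<^sub>1 \<le> t)\<close> decrease in \<open>n\<close>, so Leibniz's criterion bounds the alternating series by its
  first term.\<close>

lemma renewal_cdf_le_1: "renewal_cdf p m t \<le> 1"
proof -
  let ?a = "\<lambda>n. measure (epoch_law p m (Suc n)) {..t}"
  have "?a \<longlonglongrightarrow> 0"
    using summable_epoch_cdf_shift[OF p m, of 1 t] by (intro summable_LIMSEQ_zero) simp
  then have "renewal_cdf p m t \<le> (\<Sum>i<2 * 0 + 1. (- 1) ^ i * ?a i)"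
    unfolding renewal_cdf_def by (rule summable_Leibniz'(4)) (auto intro: epoch_cdf_antimono)
  also have "\<dots> \<le> 1" using epoch_law_prob(1)[OF p m, of "Suc 0"] by (simp add: prob_space.prob_le_1)
  finally show ?thesis .
qed

lemma renewal_density_measurable[measurable]: "renewal_density p m \<in> borel_measurable borel"
  by (rule borel_measurable_scaled_deriv[OF renewal_cdf_isCont[OF p m]])

context
  assumes nonneg: "\<And>x. 0 \<le> renewal_density p m x"
begin

lemma emeasure_renewal_measure: "emeasure (renewal_measure p m) {..t} = ennreal (renewal_cdf p m t)"
proof -
  let ?h = "renewal_density p m"
  have "emeasure (renewal_measure p m) {..t} = (\<integral>\<^sup>+x. ennreal (indicator {..t} x *\<^sub>R ?h x) \<partial>lborel)"
    unfolding renewal_measure_def by (subst emeasure_density) (auto intro!: nn_integral_cong simp: indicator_def)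
  also have "\<dots> = ennreal (LINT x:{..t}|lborel. ?h x)"
    unfolding set_lebesgue_integral_def using renewal_cdf_eq_integral(1)[OF p m, of t] nonneg
    by (intro nn_integral_eq_integral) (auto simp: set_integrable_def)
  finally show ?thesis using renewal_cdf_eq_integral(2)[OF p m, of t] by simp
qed

lemma finite_renewal_measure: "finite_measure (renewal_measure p m)"
proof (rule finite_measureI)
  have "(\<Union>n. {..real n}) = UNIV" using real_arch_simple by auto
  then have "emeasure (renewal_measure p m) (space (renewal_measure p m)) = (SUP n. emeasure (renewal_measure p m) {..real n})"
    by (subst SUP_emeasure_incseq) (auto simp: sets_renewal_measure incseq_def renewal_measure_def)
  also have "\<dots> \<le> 1"
    using renewal_cdf_le_1 by (intro SUP_least) (auto simp: emeasure_renewal_measure ennreal_le_1)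
  finally show "emeasure (renewal_measure p m) (space (renewal_measure p m)) \<noteq> \<infinity>"
    using neq_top_trans[OF ennreal_one_neq_top] by simp
qed

lemma renewal_cdf_nonneg: "0 \<le> renewal_cdf p m t"
proof -
  have "0 \<le> (LINT x:{..t}|lborel. renewal_density p m x)"
    unfolding set_lebesgue_integral_def by (rule integral_nonneg_AE) (simp add: nonneg)
  then show ?thesis using renewal_cdf_eq_integral(2)[OF p m, of t] by simp
qed

lemma measure_renewal_measure: "measure (renewal_measure p m) {..t} = renewal_cdf p m t"
  by (simp add: measure_def emeasure_renewal_measure renewal_cdf_nonneg)

text \<open>The renewal equation for characteristic functions.  The factor \<open>1 - char p t * char m t\<close> vanishes at
  \<open>t = 0\<close>, which is why the total mass has to be found by a limit.\<close>

lemma char_renewal_measure: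
  "char (renewal_measure p m) t * (1 - char p t * char m t) = char p t * (1 - char m t)"
proof -
  note P = waiting_lawD[OF p] and M = waiting_lawD[OF m] and PM = waiting_lawD[OF waiting_law_convolution[OF p m]]
  note R = finite_renewal_measure sets_renewal_measure
  have "char (renewal_measure p m) t + char (p \<star> m) t = char p t + char (renewal_measure p m \<star> (p \<star> m)) t"
  proof (rule char_add_cong_cdf)
    show "finite_measure (renewal_measure p m \<star> (p \<star> m))" by (rule convolution_finite[OF R(1) PM(3,4) R(2)])
    show "absolutely_continuous lborel (renewal_measure p m \<star> (p \<star> m))"
      by (rule absolutely_continuous_convolution[OF R(1) PM(3) R(2) PM(4,6)])
    show "absolutely_continuous lborel (renewal_measure p m)"
      unfolding renewal_measure_def by (intro absolutely_continuousI_density) simp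
    show "measure (renewal_measure p m) {..s} + measure (p \<star> m) {..s} = measure p {..s} + measure (renewal_measure p m \<star> (p \<star> m)) {..s}" for s
      using renewal_equation[OF p m, of s] measure_convolution_atMost(1)[OF R(1) PM(3) R(2) PM(4), of s]
      by (simp add: measure_renewal_measure)
  qed (simp_all add: P(3,4,6) M(3,4) PM(3,6) R)
  moreover have "char (p \<star> m) t = char p t * char m t" by (rule char_convolution[OF P(3) M(3) P(4) M(4)])
  moreover have "char (renewal_measure p m \<star> (p \<star> m)) t = char (renewal_measure p m) t * char (p \<star> m) t"
    by (rule char_convolution[OF R(1) PM(3) R(2) PM(4)])
  ultimately show ?thesis by (simp add: algebra_simps)
qed

text \<open>Divide the identity for the characteristic functions by \<open>t\<close> and let \<open>t\<close> tend to \<open>0\<close>: the factor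
  \<open>1 - char p t * char m t\<close> contributes the mean cycle length, the right-hand side the mean of \<open>m\<close>.\<close>

lemma mass_renewal_measure:
  assumes int: "integrable p (\<lambda>x. x)" "integrable m (\<lambda>x. x)" and pos: "0 < (\<integral>x. x \<partial>p) + (\<integral>x. x \<partial>m)"
  shows "measure (renewal_measure p m) UNIV = (\<integral>x. x \<partial>m) / ((\<integral>x. x \<partial>p) + (\<integral>x. x \<partial>m))"
proof -
  note P = waiting_lawD[OF p] and M = waiting_lawD[OF m]
  define \<mu> \<mu>' where "\<mu> = (\<integral>x. x \<partial>p)" and "\<mu>' = (\<integral>x. x \<partial>m)"
  define h where "h n = 1 / real (Suc n)" for n
  define a b r where "a n = char p (h n)" and "b n = char m (h n)" and "r n = char (renewal_measure p m) (h n)" for n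
  define s where "s n = complex_of_real (real (Suc n))" for n
  have one: "char p 0 = 1" "char m 0 = 1"
    using real_distribution.char_zero P(1) M(1) by auto
  have a: "(\<lambda>n. (a n - 1) * s n) \<longlonglongrightarrow> \<i> * of_real \<mu>" 
    using char_difference_quotient[OF P(3,4) int(1)] by (simp add: one a_def h_def s_def \<mu>_def)
  have b: "(\<lambda>n. (b n - 1) * s n) \<longlonglongrightarrow> \<i> * of_real \<mu>'"
    using char_difference_quotient[OF M(3,4) int(2)] by (simp add: one b_def h_def s_def \<mu>'_def)
  have a1: "a \<longlonglongrightarrow> 1"
    using char_tendsto_0[OF P(3,4)] prob_space.prob_space[OF P(2)] P(5) by (simp add: a_def[abs_def] h_def)
  have r: "r \<longlonglongrightarrow> of_real (measure (renewal_measure p m) UNIV)"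
    using char_tendsto_0[OF finite_renewal_measure sets_renewal_measure] by (simp add: r_def[abs_def] h_def)
  have eq: "r n * ((a n - 1) * s n + a n * ((b n - 1) * s n)) = a n * ((b n - 1) * s n)" for n
  proof -
    have "r n * (a n * b n - 1) = a n * (b n - 1)"
      using char_renewal_measure[of "h n"] unfolding a_def b_def r_def by (simp add: algebra_simps)
    then have "r n * (a n * b n - 1) * s n = a n * (b n - 1) * s n" by simp
    then show ?thesis by (simp add: algebra_simps)
  qed
  have "(\<lambda>n. r n * ((a n - 1) * s n + a n * ((b n - 1) * s n))) \<longlonglongrightarrow>
      of_real (measure (renewal_measure p m) UNIV) * (\<i> * of_real \<mu> + 1 * (\<i> * of_real \<mu>'))"
    by (intro tendsto_intros a b a1 r)
  moreover have "(\<lambda>n. a n * ((b n - 1) * s n)) \<longlonglongrightarrow> 1 * (\<i> * of_real \<mu>')"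
    by (intro tendsto_intros a1 b)
  ultimately have "of_real (measure (renewal_measure p m) UNIV) * (\<i> * of_real \<mu> + 1 * (\<i> * of_real \<mu>')) = 1 * (\<i> * complex_of_real \<mu>')"
    unfolding eq by (rule LIMSEQ_unique)
  then have "\<i> * complex_of_real (measure (renewal_measure p m) UNIV * (\<mu> + \<mu>')) = \<i> * complex_of_real \<mu>'"
    by (simp add: algebra_simps)
  then have "measure (renewal_measure p m) UNIV * (\<mu> + \<mu>') = \<mu>'"
    by (metis complex_i_not_zero mult_left_cancel of_real_eq_iff)
  then show ?thesis using pos by (simp add: field_simps \<mu>_def \<mu>'_def)
qed

end

end

text \<open>The law of a summand, obtained from the renewal measure by dividing by its total mass \<open>\<alpha>\<close>.\<close>

lemma normalised_renewal_density:
  assumes p: "waiting_law p" and m: "waiting_law m"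
    and int: "integrable p (\<lambda>x. x)" "integrable m (\<lambda>x. x)"
    and nonneg: "\<And>x. 0 \<le> renewal_density p m x"
    and \<alpha>: "\<alpha> = (\<integral>x. x \<partial>m) / ((\<integral>x. x \<partial>p) + (\<integral>x. x \<partial>m))"
    and f: "f = (\<lambda>x. 1 / \<alpha> * renewal_density p m x)"
  shows "f \<in> borel_measurable borel" "prob_space (density lborel (\<lambda>x. ennreal (f x)))"
    "\<alpha> * char (density lborel (\<lambda>x. ennreal (f x))) t * (1 - char p t * char m t) = char p t * (1 - char m t)"
proof -
  note mean = waiting_law_mean_pos[OF p int(1)] waiting_law_mean_pos[OF m int(2)]
  have \<alpha>0: "0 < \<alpha>" using mean by (simp add: \<alpha>)
  note h[measurable] = renewal_density_measurable[OF p m]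
  show fm[measurable]: "f \<in> borel_measurable borel" unfolding f by measurable
  have dens: "density lborel (\<lambda>x. ennreal (f x)) = density (renewal_measure p m) (\<lambda>_. ennreal (1 / \<alpha>))"
    unfolding renewal_measure_def f using \<alpha>0 nonneg
    by (subst density_density_eq) (auto simp: ennreal_mult[symmetric] mult.commute)
  have "emeasure (renewal_measure p m) UNIV = ennreal \<alpha>"
    using mass_renewal_measure[OF p m nonneg int] mean finite_measure.emeasure_eq_measure[OF finite_renewal_measure[OF p m nonneg]]
    by (simp add: \<alpha>)
  then have "emeasure (density lborel (\<lambda>x. ennreal (f x))) UNIV = ennreal (1 / \<alpha>) * ennreal \<alpha>"
    unfolding dens using sets_renewal_measure
    by (subst emeasure_density) (auto simp: sets_eq_imp_space_eq[OF sets_renewal_measure] nn_integral_cmult_indicator)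
  then show "prob_space (density lborel (\<lambda>x. ennreal (f x)))"
    using \<alpha>0 by (intro prob_spaceI) (simp add: ennreal_mult[symmetric])
  have "char (density lborel (\<lambda>x. ennreal (f x))) t = (\<integral>x. f x *\<^sub>R iexp (t * x) \<partial>lborel)"
    using \<alpha>0 nonneg by (intro char_density) (auto simp: f)
  also have "\<dots> = (\<integral>x. (1 / \<alpha>) *\<^sub>R (renewal_density p m x *\<^sub>R iexp (t * x)) \<partial>lborel)"
    by (simp only: f scaleR_scaleR)
  also have "\<dots> = (1 / \<alpha>) *\<^sub>R char (renewal_measure p m) t"
    unfolding renewal_measure_def char_density[OF h nonneg] by (rule integral_scaleR_right)
  finally have "\<alpha> * char (density lborel (\<lambda>x. ennreal (f x))) t = char (renewal_measure p m) t"
    using \<alpha>0 by (simp add: scaleR_conv_of_real)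
  then show "\<alpha> * char (density lborel (\<lambda>x. ennreal (f x))) t * (1 - char p t * char m t) = char p t * (1 - char m t)"
    using char_renewal_measure[OF p m nonneg] by simp
qed

section \<open>Expected value functions of the switch process\<close>

text \<open>Each new variable depends only on the single old coordinate \<open>e j\<close>; injectivity makes these blocks disjoint.\<close>

lemma (in prob_space) indep_vars_reindex:
  assumes ind: "indep_vars (\<lambda>_. N) X I" and e: "inj_on e L" "e ` L \<subseteq> I"
  shows "indep_vars (\<lambda>_. N) (\<lambda>j. X (e j)) L"
proof -
  have "indep_vars (\<lambda>j. PiM {e j} (\<lambda>_. N)) (\<lambda>j \<omega>. restrict (\<lambda>i. X i \<omega>) {e j}) L"
    using e by (intro indep_vars_restrict[OF ind]) (auto simp: disjoint_family_on_def inj_on_def)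
  then have "indep_vars (\<lambda>_. N) (\<lambda>j \<omega>. (\<lambda>f. f (e j)) (restrict (\<lambda>i. X i \<omega>) {e j})) L"
    by (rule indep_vars_compose2) simp
  then show ?thesis by simp
qed

text \<open>The variable \<open>Y 0\<close> plays the role of the initial state and \<open>Y (Suc k)\<close> that of the \<open>k\<close>-th duration.  Almost
  surely the epochs increase and exceed \<open>t\<close>, so the sign at time \<open>t\<close> is the alternating sum of the indicators
  of \<open>S\<^sub>n \<le> t < S\<^sub>n\<^sub>+\<^sub>1\<close>.  Integrated term by term, this is \<open>\<Sum>n. (-1)\<^sup>n (F n - F (n + 1))\<close>, and summation by
  parts with \<open>F 0 = 1\<close> gives the result.\<close>

lemma alternating_sign_expectation:
  fixes Y :: "nat \<Rightarrow> 'a \<Rightarrow> real" and s :: real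
  assumes M: "prob_space M" and ind: "prob_space.indep_vars M (\<lambda>_. borel) Y UNIV"
    and law: "\<And>k. distr M borel (Y (Suc k)) = (if even k then p else m)"
    and p: "waiting_law p" and m: "waiting_law m" and t: "0 \<le> t"
  defines "S \<equiv> \<lambda>n \<omega>. \<Sum>k<n. Y (Suc k) \<omega>"
  defines "A \<equiv> {\<omega>\<in>space M. Y 0 \<omega> = s}"
  shows "(\<integral>\<omega>. indicator A \<omega> * (-1) ^ (LEAST n. S n \<omega> \<le> t \<and> t < S (Suc n) \<omega>) \<partial>M) =
    measure M A * (1 - 2 * renewal_cdf p m t)"
proof -
  interpret prob_space M by fact
  have rv[measurable]: "Y k \<in> borel_measurable M" for k
    using ind by (auto simp: indep_vars_def)
  have [measurable]: "S n \<in> borel_measurable M" for n unfolding S_def by measurable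
  have [measurable]: "A \<in> sets M" unfolding A_def by measurable
  have S_Suc: "S (Suc n) \<omega> = S n \<omega> + Y (Suc n) \<omega>" for n \<omega> by (simp add: S_def)
  have S_image: "S n \<omega> = (\<Sum>i\<in>Suc ` {..<n}. Y i \<omega>)" for n \<omega> by (simp add: S_def sum.reindex)
  have S_law: "distr M borel (S n) = epoch_law p m n" for n
  proof (induction n)
    case 0
    have "distr M borel (\<lambda>\<omega>. 0 :: real) = return borel 0"
      by (rule distr_const) simp
    then show ?case by (simp add: S_def)
  next
    case (Suc n)
    let ?q = "if even n then p else m"
    have "indep_var borel (Y (Suc n)) borel (S n)"
      unfolding S_image by (intro indep_vars_sum indep_vars_subset[OF ind]) auto
    then have "distr M borel (\<lambda>\<omega>. Y (Suc n) \<omega> + S n \<omega>) = (?q \<star> epoch_law p m n)"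
      using sum_indep_random_variable[of "Y (Suc n)" "S n"] by (simp add: Suc law)
    also have "\<dots> = epoch_law p m (Suc n)"
      unfolding epoch_law.simps(2)
      by (rule convolution_commutative[OF waiting_lawD(3)[OF alternating_law[OF p m]] epoch_law_prob(2)[OF p m]
        epoch_law_sets[OF p m] waiting_lawD(4)[OF alternating_law[OF p m]]])
    also have "(\<lambda>\<omega>. Y (Suc n) \<omega> + S n \<omega>) = S (Suc n)"
      by (auto simp: S_Suc)
    finally show ?case .
  qed
  define F where "F n = measure (epoch_law p m n) {..t}" for n
  have F: "prob {\<omega>\<in>space M. S n \<omega> \<le> t} = F n" for n
    unfolding F_def S_law[symmetric] by (subst measure_distr) (auto intro!: arg_cong[where f=prob])
  have AF: "prob (A \<inter> {\<omega>\<in>space M. S n \<omega> \<le> t}) = prob A * F n" for n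
  proof -
    have "indep_var borel (Y 0) borel (S n)"
      unfolding S_image by (intro indep_vars_sum indep_vars_subset[OF ind]) auto
    from indep_varD[OF this, of "{s}" "{..t}"]
    have "prob ((\<lambda>\<omega>. (Y 0 \<omega>, S n \<omega>)) -` ({s} \<times> {..t}) \<inter> space M) = prob (Y 0 -` {s} \<inter> space M) * prob (S n -` {..t} \<inter> space M)"
      by simp
    moreover have "(\<lambda>\<omega>. (Y 0 \<omega>, S n \<omega>)) -` ({s} \<times> {..t}) \<inter> space M = A \<inter> {\<omega>\<in>space M. S n \<omega> \<le> t}"
      "Y 0 -` {s} \<inter> space M = A" "S n -` {..t} \<inter> space M = {\<omega>\<in>space M. S n \<omega> \<le> t}"
      by (auto simp: A_def)
    ultimately show ?thesis by (simp add: F)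
  qed
  have sumF: "summable F" unfolding F_def by (rule summable_epoch_cdf[OF p m])
  have "AE \<omega> in M. \<forall>k. 0 \<le> Y (Suc k) \<omega>"
  proof (rule AE_all_countable[THEN iffD2], rule allI)
    fix k
    have "AE x in distr M borel (Y (Suc k)). 0 \<le> x"
      unfolding law by (rule waiting_lawD(7)[OF alternating_law[OF p m]])
    then show "AE \<omega> in M. 0 \<le> Y (Suc k) \<omega>" by (subst (asm) AE_distr_iff) auto
  qed
  then have mono: "AE \<omega> in M. mono (\<lambda>n. S n \<omega>)"
    by (rule eventually_mono) (auto simp: mono_iff_le_Suc S_Suc)
  have "prob {\<omega>\<in>space M. \<forall>n. S n \<omega> \<le> t} \<le> F n" for n
    unfolding F[symmetric] by (rule finite_measure_mono) auto
  then have "prob {\<omega>\<in>space M. \<forall>n. S n \<omega> \<le> t} \<le> 0"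
    using summable_LIMSEQ_zero[OF sumF] by (intro LIMSEQ_le_const[of F]) auto
  then have "prob {\<omega>\<in>space M. \<forall>n. S n \<omega> \<le> t} = 0"
    using measure_nonneg[of M "{\<omega>\<in>space M. \<forall>n. S n \<omega> \<le> t}"] by linarith
  then have "emeasure M {\<omega>\<in>space M. \<forall>n. S n \<omega> \<le> t} = 0" by (simp add: emeasure_eq_measure)
  then have escape: "AE \<omega> in M. \<not> (\<forall>n. S n \<omega> \<le> t)"
    by (intro AE_I[of _ _ "{\<omega>\<in>space M. \<forall>n. S n \<omega> \<le> t}"]) auto
  \<comment> \<open>For increasing epochs \<open>J n\<close> is the indicator of \<open>A \<inter> {S\<^sub>n \<le> t < S\<^sub>n\<^sub>+\<^sub>1}\<close>; the difference form makes
    its expectation computable from the distribution functions of single epochs.\<close>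
  define J where "J n \<omega> = indicator A \<omega> * (indicator {..t} (S n \<omega>) - indicator {..t} (S (Suc n) \<omega>) :: real)" for n \<omega>
  have [measurable]: "J n \<in> borel_measurable M" for n unfolding J_def by measurable
  have located: "AE \<omega> in M. \<exists>n0. (LEAST n. S n \<omega> \<le> t \<and> t < S (Suc n) \<omega>) = n0 \<and>
      J n0 \<omega> = indicator A \<omega> \<and> (\<forall>n. n \<noteq> n0 \<longrightarrow> J n \<omega> = 0) \<and> (\<forall>n. 0 \<le> J n \<omega>)"
    using mono escape
  proof (rule eventually_elim2)
    fix \<omega> assume mono: "mono (\<lambda>n. S n \<omega>)" and "\<not> (\<forall>n. S n \<omega> \<le> t)"
    then obtain l where "t < S l \<omega>" by (auto simp: not_le)
    define l where "l = (LEAST l. t < S l \<omega>)"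
    have l: "t < S l \<omega>" "\<And>k. k < l \<Longrightarrow> S k \<omega> \<le> t"
      unfolding l_def by (rule LeastI, fact) (use not_less_Least in \<open>auto simp: not_less[symmetric]\<close>)
    have "l \<noteq> 0" using l(1) t by (intro notI) (simp add: S_def)
    then obtain n0 where n0: "l = Suc n0" using not0_implies_Suc by blast
    have below: "S n \<omega> \<le> t \<longleftrightarrow> n \<le> n0" for n
      using l monoD[OF mono, of l n] by (cases "n < l") (auto simp: n0)
    have "(LEAST n. S n \<omega> \<le> t \<and> t < S (Suc n) \<omega>) = n0"
      by (rule Least_equality) (auto simp: below not_le[symmetric])
    moreover have "J n \<omega> = indicator A \<omega> * (if n = n0 then 1 else 0)" for n
      by (auto simp: J_def indicator_def below)
    ultimately show "\<exists>n0. (LEAST n. S n \<omega> \<le> t \<and> t < S (Suc n) \<omega>) = n0 \<and>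
      J n0 \<omega> = indicator A \<omega> \<and> (\<forall>n. n \<noteq> n0 \<longrightarrow> J n \<omega> = 0) \<and> (\<forall>n. 0 \<le> J n \<omega>)" by auto
  qed
  have J_int: "integrable M (J n)" for n
    by (rule integrable_const_bound[where B=1]) (auto simp: J_def indicator_def)
  have J_value: "integral\<^sup>L M (J n) = prob A * (F n - F (Suc n))" for n
  proof -
    have *: "(\<integral>\<omega>. indicator (A \<inter> {\<omega>\<in>space M. S k \<omega> \<le> t}) \<omega> \<partial>M) = prob A * F k" for k
      using AF[of k] by (simp add: Int_absorb2[of "A \<inter> {\<omega>\<in>space M. S k \<omega> \<le> t}" "space M"] le_infI2 subset_iff)
    have "integral\<^sup>L M (J n) = (\<integral>\<omega>. indicator (A \<inter> {\<omega>\<in>space M. S n \<omega> \<le> t}) \<omega> -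
        (indicator (A \<inter> {\<omega>\<in>space M. S (Suc n) \<omega> \<le> t}) \<omega> :: real) \<partial>M)"
      by (intro Bochner_Integration.integral_cong) (auto simp: J_def indicator_def)
    also have "\<dots> = prob A * F n - prob A * F (Suc n)"
      unfolding *[symmetric] by (rule Bochner_Integration.integral_diff) (auto simp: emeasure_eq_measure)
    finally show ?thesis by (simp add: right_diff_distrib)
  qed
  have s1: "summable (\<lambda>n. (-1) ^ n * F (Suc n))"
    using summable_renewal_cdf[OF p m] by (simp add: F_def)
  have s0: "summable (\<lambda>n. (-1) ^ n * F n)"
    using summable_mult[OF s1, of "-1"] by (subst summable_Suc_iff[symmetric]) simp
  have sumF': "summable (\<lambda>n. F n - F (Suc n))"
    using sumF summable_Suc_iff[of F] by (intro summable_diff) auto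
  have "(\<integral>\<omega>. indicator A \<omega> * (-1) ^ (LEAST n. S n \<omega> \<le> t \<and> t < S (Suc n) \<omega>) \<partial>M) = (\<integral>\<omega>. (\<Sum>n. (-1) ^ n * J n \<omega>) \<partial>M)"
  proof (rule integral_cong_AE)
    show "AE \<omega> in M. indicator A \<omega> * (-1) ^ (LEAST n. S n \<omega> \<le> t \<and> t < S (Suc n) \<omega>) = (\<Sum>n. (-1) ^ n * J n \<omega>)"
      using located
    proof (rule eventually_mono, elim exE conjE)
      fix \<omega> n0 assume *: "(LEAST n. S n \<omega> \<le> t \<and> t < S (Suc n) \<omega>) = n0" "J n0 \<omega> = indicator A \<omega>" "\<forall>n. n \<noteq> n0 \<longrightarrow> J n \<omega> = 0"
      have "(\<Sum>n. (-1) ^ n * J n \<omega>) = (-1) ^ n0 * J n0 \<omega>"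
        using suminf_finite[of "{n0}" "\<lambda>n. (-1) ^ n * J n \<omega>"] *(3) by simp
      then show "indicator A \<omega> * (-1) ^ (LEAST n. S n \<omega> \<le> t \<and> t < S (Suc n) \<omega>) = (\<Sum>n. (-1) ^ n * J n \<omega>)"
        unfolding *(1,2) by (simp only: mult.commute)
    qed
  qed measurable
  also have "\<dots> = (\<Sum>n. \<integral>\<omega>. (-1) ^ n * J n \<omega> \<partial>M)"
  proof (rule integral_suminf)
    show "integrable M (\<lambda>\<omega>. (-1) ^ n * J n \<omega>)" for n using J_int by simp
    show "AE \<omega> in M. summable (\<lambda>n. norm ((-1) ^ n * J n \<omega>))"
      using located
    proof (rule eventually_mono, elim exE conjE)
      fix \<omega> n0 assume "\<forall>n. n \<noteq> n0 \<longrightarrow> J n \<omega> = 0"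
      then show "summable (\<lambda>n. norm ((-1) ^ n * J n \<omega>))"
        by (intro summable_finite[of "{n0}"]) auto
    qed
    have "(\<integral>\<omega>. norm ((-1) ^ n * J n \<omega>) \<partial>M) = prob A * (F n - F (Suc n))" for n
      unfolding J_value[symmetric]
    proof (rule integral_cong_AE)
      show "AE \<omega> in M. norm ((-1) ^ n * J n \<omega>) = J n \<omega>"
        using located by (rule eventually_mono) (auto simp: abs_mult)
    qed measurable
    then show "summable (\<lambda>n. \<integral>\<omega>. norm ((-1) ^ n * J n \<omega>) \<partial>M)"
      using sumF' by (simp add: summable_mult)
  qed
  also have "\<dots> = (\<Sum>n. prob A * ((-1) ^ n * F n + (-1) * ((-1) ^ n * F (Suc n))))"
    by (simp add: J_value algebra_simps)
  also have "\<dots> = prob A * ((\<Sum>n. (-1) ^ n * F n) + (-1) * (\<Sum>n. (-1) ^ n * F (Suc n)))"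
    by (subst suminf_mult, intro summable_add s0 summable_mult s1)
      (subst suminf_add[symmetric, OF s0 summable_mult[OF s1]], subst suminf_mult[OF s1], simp)
  also have "(\<Sum>n. (-1) ^ n * F n) = 1 - renewal_cdf p m t"
  proof -
    have "(\<Sum>n. (-1) ^ Suc n * F (Suc n)) = (\<Sum>n. (-1) ^ n * F n) - F 0"
      using suminf_split_head[OF s0] by simp
    moreover have "(\<Sum>n. (-1) ^ Suc n * F (Suc n)) = - renewal_cdf p m t"
      using suminf_minus[OF s1] by (simp add: renewal_cdf_def F_def)
    moreover have "F 0 = 1" using t by (simp add: F_def measure_return)
    ultimately show ?thesis by simp
  qed
  also have "(\<Sum>n. (-1) ^ n * F (Suc n)) = renewal_cdf p m t" by (simp add: renewal_cdf_def F_def)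
  finally show ?thesis by simp
qed

text \<open>If \<open>A\<close> is a null set both sides are \<open>0\<close>: the left-hand side as an integral over the null measure, the
  right-hand side as a quotient by \<open>0\<close>.\<close>

lemma integral_uniform_measure:
  fixes f :: "'a \<Rightarrow> real"
  assumes "prob_space M" and A[measurable]: "A \<in> sets M" and f[measurable]: "f \<in> borel_measurable M"
  shows "(\<integral>\<omega>. f \<omega> \<partial>uniform_measure M A) = (\<integral>\<omega>. indicator A \<omega> * f \<omega> \<partial>M) / measure M A"
proof -
  interpret prob_space M by fact
  show ?thesis
  proof (cases "measure M A = 0")
    case True
    then have A0: "emeasure M A = 0" by (simp add: emeasure_eq_measure)
    then have "AE \<omega> in M. indicator A \<omega> / emeasure M A = (0::ennreal)"
      using AE_not_in[of A M] by (auto simp: null_sets_def elim!: eventually_mono)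
    then have "uniform_measure M A = density M (\<lambda>_. 0)"
      unfolding uniform_measure_def by (intro density_cong) auto
    also have "\<dots> = null_measure M" by (rule null_measure_eq_density[symmetric])
    finally show ?thesis using True by simp
  next
    case False
    then have pos: "0 < measure M A" by (simp add: zero_less_measure_iff)
    have "uniform_measure M A = density M (\<lambda>\<omega>. ennreal (indicator A \<omega> / measure M A))"
      unfolding uniform_measure_def
      by (intro arg_cong[where f="density M"]) (use pos in \<open>auto simp: indicator_def emeasure_eq_measure fun_eq_iff divide_ennreal[symmetric]\<close>)
    then have "(\<integral>\<omega>. f \<omega> \<partial>uniform_measure M A) = (\<integral>\<omega>. (indicator A \<omega> / measure M A) * f \<omega> \<partial>M)"
      by (simp add: integral_density)
    also have "\<dots> = (\<integral>\<omega>. indicator A \<omega> * f \<omega> / measure M A \<partial>M)" by (simp only: times_divide_eq_left)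
    finally show ?thesis by simp
  qed
qed

lemma switch_epoch_eq:
  "switch_epoch (\<lambda>k. a (int k + 1) \<omega>) (\<lambda>k. b (int k + 1) \<omega>) n =
    (\<Sum>k<n. (if even k then a (int (k div 2) + 1) else b (int (k div 2) + 1)) \<omega>)"
  unfolding switch_epoch_def by (intro sum.cong) auto

text \<open>The initial state and the durations on the positive half-line, in the order in which a path uses them; the
  two parts belong to the two initial states.\<close>

lemma switch_data_indep:
  assumes data: "switch_data P Tp Tm M \<delta> Tps Tms"
  shows "prob_space.indep_vars M (\<lambda>_. borel) (\<lambda>n. case n of 0 \<Rightarrow> \<delta> | Suc k \<Rightarrow>
      (if even k then Tps (int (k div 2) + 1) else Tms (int (k div 2) + 1))) UNIV"
    and "prob_space.indep_vars M (\<lambda>_. borel) (\<lambda>n. case n of 0 \<Rightarrow> \<delta> | Suc k \<Rightarrow>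
      (if even k then Tms (int (k div 2) + 1) else Tps (int (k div 2) + 1))) UNIV"
proof -
  let ?I = "{Start} \<union> Plus ` {i. i \<noteq> 0} \<union> Minus ` {i. i \<noteq> 0}"
  interpret prob_space M using data by (simp add: switch_data_def)
  have ind: "indep_vars (\<lambda>_. borel) (switch_family \<delta> Tps Tms) ?I"
    using data by (simp add: switch_data_def)
  define e where "e a b n = (case n of 0 \<Rightarrow> Start | Suc k \<Rightarrow> (if even k then a (int (k div 2) + 1) else b (int (k div 2) + 1)))"
    for a b :: "int \<Rightarrow> switch_index" and n
  have div2: "k = k'" if "k div 2 = k' div 2" "even k = even k'" for k k' :: nat
    using that by (metis div_mult_mod_eq even_iff_mod_2_eq_zero not_mod_2_eq_1_eq_0)
  have inj: "inj (e Plus Minus)" "inj (e Minus Plus)"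
    by (auto simp: inj_def e_def split: nat.splits if_splits intro: div2)
  have "indep_vars (\<lambda>_. borel) (\<lambda>n. switch_family \<delta> Tps Tms (e Plus Minus n)) UNIV"
    by (rule indep_vars_reindex[OF ind inj(1)]) (auto simp: e_def split: nat.splits)
  also have "(\<lambda>n. switch_family \<delta> Tps Tms (e Plus Minus n)) = (\<lambda>n. case n of 0 \<Rightarrow> \<delta> | Suc k \<Rightarrow>
      (if even k then Tps (int (k div 2) + 1) else Tms (int (k div 2) + 1)))"
    by (auto simp: e_def fun_eq_iff split: nat.splits)
  finally show "indep_vars (\<lambda>_. borel) \<dots> UNIV" .
  have "indep_vars (\<lambda>_. borel) (\<lambda>n. switch_family \<delta> Tps Tms (e Minus Plus n)) UNIV"
    by (rule indep_vars_reindex[OF ind inj(2)]) (auto simp: e_def split: nat.splits)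
  also have "(\<lambda>n. switch_family \<delta> Tps Tms (e Minus Plus n)) = (\<lambda>n. case n of 0 \<Rightarrow> \<delta> | Suc k \<Rightarrow>
      (if even k then Tms (int (k div 2) + 1) else Tps (int (k div 2) + 1)))"
    by (auto simp: e_def fun_eq_iff split: nat.splits)
  finally show "indep_vars (\<lambda>_. borel) \<dots> UNIV" .
qed

lemma expected_value_eq_renewal_cdf:
  assumes data: "switch_data P Tp Tm M \<delta> Tps Tms" and t: "0 \<le> t"
    and p: "waiting_law (distr P borel Tp)" and m: "waiting_law (distr P borel Tm)"
  shows "0 < measure M {\<omega>\<in>space M. \<delta> \<omega> = 1} \<Longrightarrow>
      expected_value M \<delta> (switch_process \<delta> Tps Tms) 1 t = 1 - 2 * renewal_cdf (distr P borel Tp) (distr P borel Tm) t"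
    and "0 < measure M {\<omega>\<in>space M. \<delta> \<omega> = -1} \<Longrightarrow>
      expected_value M \<delta> (switch_process \<delta> Tps Tms) (-1) t = -1 + 2 * renewal_cdf (distr P borel Tm) (distr P borel Tp) t"
proof -
  interpret prob_space M using data by (simp add: switch_data_def)
  define Y where "Y = (\<lambda>n. case n of 0 \<Rightarrow> \<delta> | Suc k \<Rightarrow>
      (if even k then Tps (int (k div 2) + 1) else Tms (int (k div 2) + 1)))"
  define Z where "Z = (\<lambda>n. case n of 0 \<Rightarrow> \<delta> | Suc k \<Rightarrow>
      (if even k then Tms (int (k div 2) + 1) else Tps (int (k div 2) + 1)))"
  have Y: "indep_vars (\<lambda>_. borel) Y UNIV" and Z: "indep_vars (\<lambda>_. borel) Z UNIV"
    unfolding Y_def Z_def by (fact switch_data_indep[OF data])+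
  have laws: "distr M borel (Y (Suc k)) = (if even k then distr P borel Tp else distr P borel Tm)"
    "distr M borel (Z (Suc k)) = (if even k then distr P borel Tm else distr P borel Tp)" for k
    using data by (auto simp: switch_data_def Y_def Z_def)
  have [measurable]: "Y n \<in> borel_measurable M" "Z n \<in> borel_measurable M" for n
    using Y Z by (auto simp: indep_vars_def)
  have [measurable]: "\<delta> \<in> borel_measurable M" using \<open>Y 0 \<in> borel_measurable M\<close> by (simp add: Y_def)
  define U where "U W \<omega> = (-1::real) ^ (LEAST n. (\<Sum>k<n. W (Suc k) \<omega>) \<le> t \<and> t < (\<Sum>k<Suc n. W (Suc k) \<omega>))"
    for W :: "nat \<Rightarrow> 'b \<Rightarrow> real" and \<omega>
  have [measurable]: "U Y \<in> borel_measurable M" "U Z \<in> borel_measurable M"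
    unfolding U_def by measurable
  have D: "switch_process \<delta> Tps Tms t = (\<lambda>\<omega>. if \<delta> \<omega> = 1 then U Y \<omega> else - U Z \<omega>)"
    using t unfolding switch_process_def Let_def forward_sign_def switch_epoch_eq U_def
    by (auto simp: fun_eq_iff Y_def Z_def)
  have [measurable]: "switch_process \<delta> Tps Tms t \<in> borel_measurable M" unfolding D by measurable
  let ?A = "\<lambda>s. {\<omega>\<in>space M. \<delta> \<omega> = s}"
  have ev: "expected_value M \<delta> (switch_process \<delta> Tps Tms) s t =
      (\<integral>\<omega>. indicator (?A s) \<omega> * (if s = 1 then U Y \<omega> else - U Z \<omega>) \<partial>M) / prob (?A s)" for s
    unfolding expected_value_def
    by (subst integral_uniform_measure[OF prob_space_axioms])
      (auto simp: D indicator_def intro!: arg_cong2[where f="(/)"] Bochner_Integration.integral_cong)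
  have "(\<integral>\<omega>. indicator (?A s) \<omega> * U Y \<omega> \<partial>M) = prob (?A s) * (1 - 2 * renewal_cdf (distr P borel Tp) (distr P borel Tm) t)" for s
    using alternating_sign_expectation[OF prob_space_axioms Y laws(1) p m t, of s]
    by (simp add: U_def Y_def)
  then show "0 < measure M {\<omega>\<in>space M. \<delta> \<omega> = 1} \<Longrightarrow>
      expected_value M \<delta> (switch_process \<delta> Tps Tms) 1 t = 1 - 2 * renewal_cdf (distr P borel Tp) (distr P borel Tm) t"
    by (simp add: ev)
  have "(\<integral>\<omega>. indicator (?A s) \<omega> * U Z \<omega> \<partial>M) = prob (?A s) * (1 - 2 * renewal_cdf (distr P borel Tm) (distr P borel Tp) t)" for s
    using alternating_sign_expectation[OF prob_space_axioms Z laws(2) m p t, of s]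
    by (simp add: U_def Z_def)
  then show "0 < measure M {\<omega>\<in>space M. \<delta> \<omega> = -1} \<Longrightarrow>
      expected_value M \<delta> (switch_process \<delta> Tps Tms) (-1) t = -1 + 2 * renewal_cdf (distr P borel Tm) (distr P borel Tp) t"
    by (simp add: ev field_simps)
qed

text \<open>The derivatives are taken at positive points only, which have neighbourhoods on the positive half-line; the
  relation between \<open>E\<close> and \<open>G\<close> may therefore be restricted to it.\<close>

lemma scaled_deriv_affine:
  assumes E: "\<And>t. 0 \<le> t \<Longrightarrow> E t = a + b * G t" and b: "b \<noteq> 0"
  shows "scaled_deriv c E = (\<lambda>t. c * b * scaled_deriv 1 G t)"
proof -
  have to: "(E has_real_derivative b * d) (at t)" if "(G has_real_derivative d) (at t)" "0 < t" for t d
  proof (rule has_field_derivative_transform_within_open[of "\<lambda>t. a + b * G t" _ _ "{0<..}"])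
    show "((\<lambda>t. a + b * G t) has_real_derivative b * d) (at t)"
      using that(1) by (auto intro!: derivative_eq_intros)
  qed (use that E in auto)
  have conversely: "(G has_real_derivative d / b) (at t)" if "(E has_real_derivative d) (at t)" "0 < t" for t d
  proof (rule has_field_derivative_transform_within_open[of "\<lambda>t. (E t - a) / b" _ _ "{0<..}"])
    show "((\<lambda>t. (E t - a) / b) has_real_derivative d / b) (at t)"
      using that(1) b by (auto intro!: derivative_eq_intros)
  qed (use that E b in auto)
  have diff: "E differentiable (at t) \<longleftrightarrow> G differentiable (at t)" if "0 < t" for t
    using to conversely that unfolding real_differentiable_def by blast
  have "deriv E t = b * deriv G t" if "0 < t" "G differentiable (at t)" for t
  proof -
    have "(G has_real_derivative deriv G t) (at t)"
      using that(2) DERIV_deriv_iff_real_differentiable by blast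
    from to[OF this that(1)] show ?thesis by (rule DERIV_imp_deriv)
  qed
  then show "scaled_deriv c E = (\<lambda>t. c * b * scaled_deriv 1 G t)"
    using diff by (auto simp: scaled_deriv_def fun_eq_iff)
qed


lemma switching_time_waiting_law:
  assumes P: "prob_space P" and T: "switching_time P T f"
  shows "waiting_law (distr P borel T)" "integrable (distr P borel T) (\<lambda>x. x)"
    "(\<integral>x. x \<partial>distr P borel T) = integral\<^sup>L P T"
proof -
  interpret prob_space P by fact
  have [measurable]: "T \<in> borel_measurable P" using T by (simp add: switching_time_def)
  have "real_distribution (distr P borel T)"
    by (simp add: real_distribution_def real_distribution_axioms_def prob_space_distr)
  moreover have "distr P borel T = distr P lborel T" by (rule distr_cong) simp_all
  then have "distr P borel T = density lborel (\<lambda>t. ennreal (f t))" "(\<lambda>t. ennreal (f t)) \<in> borel_measurable lborel"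
    using T by (auto simp: switching_time_def distributed_def)
  then have "absolutely_continuous lborel (distr P borel T)"
    by (simp only:) (rule absolutely_continuousI_density)
  moreover have "AE x in distr P borel T. 0 \<le> x"
    using T by (subst AE_distr_iff) (auto simp: switching_time_def)
  ultimately show "waiting_law (distr P borel T)" by (simp add: waiting_law_def)
  show "integrable (distr P borel T) (\<lambda>x. x)"
    using T by (simp add: integrable_distr_eq switching_time_def)
  show "(\<integral>x. x \<partial>distr P borel T) = integral\<^sup>L P T" by (simp add: integral_distr)
qed

section \<open>Geometric sums\<close>

text \<open>A geometric variable is specified on the positive integers only; these probabilities already add up to \<open>1\<close>,
  so the value \<open>0\<close> has probability \<open>0\<close>.\<close>

lemma geometric_rv_AE_pos:
  assumes N: "prob_space N" and \<nu>: "geometric_rv N p \<nu>" and p: "0 < p" "p < 1"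
  shows "AE \<omega> in N. 1 \<le> \<nu> \<omega>"
proof -
  interpret prob_space N by fact
  have [measurable]: "\<nu> \<in> measurable N (count_space UNIV)" using \<nu> by (simp add: geometric_rv_def)
  have pk: "prob {\<omega>\<in>space N. \<nu> \<omega> = k} = (1 - p) ^ (k - 1) * p" if "1 \<le> k" for k
    using \<nu> that by (auto simp: geometric_rv_def)
  have "prob {\<omega>\<in>space N. \<nu> \<omega> = 0} \<le> (1 - p) ^ n" for n
  proof -
    have "(\<Sum>k\<in>{0..n}. prob {\<omega>\<in>space N. \<nu> \<omega> = k}) = prob (\<Union>k\<in>{0..n}. {\<omega>\<in>space N. \<nu> \<omega> = k})"
      by (intro finite_measure_finite_Union[symmetric]) (auto simp: disjoint_family_on_def)
    then have "prob {\<omega>\<in>space N. \<nu> \<omega> = 0} + (\<Sum>k=1..n. prob {\<omega>\<in>space N. \<nu> \<omega> = k}) \<le> 1"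
      by (simp add: sum.atLeast_Suc_atMost)
    moreover have "(\<Sum>k=1..n. prob {\<omega>\<in>space N. \<nu> \<omega> = k}) = 1 - (1 - p) ^ n"
    proof -
      have "(\<Sum>k=1..n. prob {\<omega>\<in>space N. \<nu> \<omega> = k}) = (\<Sum>k=1..n. (1 - p) ^ (k - 1) * p)"
        by (intro sum.cong) (auto simp: pk)
      also have "\<dots> = 1 - (1 - p) ^ n"
        by (induction n) (auto simp: algebra_simps)
      finally show ?thesis .
    qed
    ultimately show ?thesis by simp
  qed
  then have "prob {\<omega>\<in>space N. \<nu> \<omega> = 0} \<le> 0"
    using p by (intro LIMSEQ_le_const[OF LIMSEQ_power_zero[of "1 - p"]]) auto
  then have "prob {\<omega>\<in>space N. \<nu> \<omega> = 0} = 0"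
    using measure_nonneg[of N "{\<omega>\<in>space N. \<nu> \<omega> = 0}"] by linarith
  then have "emeasure N {\<omega>\<in>space N. \<nu> \<omega> = 0} = 0" by (simp add: emeasure_eq_measure)
  then show ?thesis
    by (intro AE_I[of _ _ "{\<omega>\<in>space N. \<nu> \<omega> = 0}"]) auto
qed

text \<open>Decompose over the values \<open>j\<close>, \<open>k\<close> of the two counts.  On each piece only finitely many members of the
  independent family occur, so the expectation factorises and the pieces sum to a product of two geometric
  series.\<close>

lemma char_geometric_sums:
  assumes G: "geometric_sum_data \<alpha> \<beta> fX fY N \<nu>a \<nu>b X Y"
    and \<alpha>: "0 < \<alpha>" "\<alpha> < 1" and \<beta>: "0 < \<beta>" "\<beta> < 1"
  defines "x \<equiv> char (density lborel (\<lambda>t. ennreal (fX t)))" and "y \<equiv> char (density lborel (\<lambda>t. ennreal (fY t)))"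
  shows "char (distr N borel (\<lambda>\<omega>. (\<Sum>k=1..\<nu>b \<omega>. X k \<omega>) + (\<Sum>k=1..\<nu>a \<omega>. Y k \<omega>))) t =
    (of_real \<beta> * x t / (1 - of_real (1 - \<beta>) * x t)) * (of_real \<alpha> * y t / (1 - of_real (1 - \<alpha>) * y t))"
    and "(\<lambda>\<omega>. (\<Sum>k=1..\<nu>b \<omega>. X k \<omega>) + (\<Sum>k=1..\<nu>a \<omega>. Y k \<omega>)) \<in> borel_measurable N"
proof -
  interpret prob_space N using G by (simp add: geometric_sum_data_def)
  let ?I = "{Nu_alpha, Nu_beta} \<union> X_idx ` {1..} \<union> Y_idx ` {1..}"
  have ind: "indep_vars (\<lambda>_. borel) (sum_family \<nu>a \<nu>b X Y) ?I"
    and geo: "geometric_rv N \<alpha> \<nu>a" "geometric_rv N \<beta> \<nu>b"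
    and laws: "\<And>k. 1 \<le> k \<Longrightarrow> distributed N lborel (X k) (\<lambda>t. ennreal (fX t))"
      "\<And>k. 1 \<le> k \<Longrightarrow> distributed N lborel (Y k) (\<lambda>t. ennreal (fY t))"
    using G by (simp_all add: geometric_sum_data_def)
  have rv: "X k \<in> borel_measurable N" "Y k \<in> borel_measurable N" if "1 \<le> k" for k
    using laws(1)[OF that] laws(2)[OF that] by (auto simp: distributed_def)
  have [measurable]: "\<nu>a \<in> measurable N (count_space UNIV)" "\<nu>b \<in> measurable N (count_space UNIV)"
    using geo by (simp_all add: geometric_rv_def)
  have pk: "prob {\<omega>\<in>space N. \<nu>a \<omega> = k} = (1 - \<alpha>) ^ (k - 1) * \<alpha>"
      "prob {\<omega>\<in>space N. \<nu>b \<omega> = k} = (1 - \<beta>) ^ (k - 1) * \<beta>" if "1 \<le> k" for k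
    using geo that by (auto simp: geometric_rv_def)
  define SX SY where "SX n \<omega> = (\<Sum>k=1..n. X k \<omega>)" and "SY n \<omega> = (\<Sum>k=1..n. Y k \<omega>)" for n \<omega>
  have [measurable]: "SX n \<in> borel_measurable N" "SY n \<in> borel_measurable N" for n
    unfolding SX_def SY_def by (auto intro!: borel_measurable_sum rv)
  have [measurable]: "(\<lambda>\<omega>. SX (\<nu>b \<omega>) \<omega>) \<in> borel_measurable N" "(\<lambda>\<omega>. SY (\<nu>a \<omega>) \<omega>) \<in> borel_measurable N"
    by (rule measurable_compose_countable[where g=\<nu>b and f=SX] measurable_compose_countable[where g=\<nu>a and f=SY]; simp)+
  define Z where "Z \<omega> = SX (\<nu>b \<omega>) \<omega> + SY (\<nu>a \<omega>) \<omega>" for \<omega>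
  have Z_eq: "(\<lambda>\<omega>. (\<Sum>k=1..\<nu>b \<omega>. X k \<omega>) + (\<Sum>k=1..\<nu>a \<omega>. Y k \<omega>)) = Z"
    by (auto simp: Z_def SX_def SY_def)
  have Z[measurable]: "Z \<in> borel_measurable N" unfolding Z_def by measurable
  show "(\<lambda>\<omega>. (\<Sum>k=1..\<nu>b \<omega>. X k \<omega>) + (\<Sum>k=1..\<nu>a \<omega>. Y k \<omega>)) \<in> borel_measurable N"
    unfolding Z_eq by (rule Z)
  have charX: "(\<integral>\<omega>. iexp (t * X k \<omega>) \<partial>N) = x t" "(\<integral>\<omega>. iexp (t * Y k \<omega>) \<partial>N) = y t" if "1 \<le> k" for k
    using laws(1)[OF that] laws(2)[OF that] rv[OF that] unfolding x_def y_def char_def distributed_def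
    by (auto simp: integral_distr dest!: sym[of _ "density _ _"])
  \<comment> \<open>The part of the integrand that belongs to the event that \<open>j\<close> summands \<open>X\<close> and \<open>k\<close> summands \<open>Y\<close> occur.\<close>
  define W where "W j k \<omega> = (if \<nu>b \<omega> = j \<and> \<nu>a \<omega> = k then iexp (t * (SX j \<omega> + SY k \<omega>)) else 0)"
    for j k :: nat and \<omega>
  have [measurable]: "W j k \<in> borel_measurable N" for j k
    unfolding W_def by measurable
  have W_int: "integrable N (W j k)" for j k
    by (rule integrable_const_bound[where B=1]) (auto simp: W_def indicator_def)
  have indicator_value: "(\<integral>\<omega>. complex_of_real (indicator B \<omega>) \<partial>N) = of_real (prob B)" if "B \<in> sets N" for B
  proof -
    have "integrable N (indicat_real B)" using that by (simp add: emeasure_eq_measure)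
    moreover have "integral\<^sup>L N (indicat_real B) = prob B"
      using sets.sets_into_space[OF that] by (simp add: Int_absorb2)
    ultimately show ?thesis by (simp add: integral_of_real)
  qed
  have W_value: "integral\<^sup>L N (W j k) = (of_real ((1 - \<beta>) ^ (j - 1) * \<beta>) * x t ^ j) * (of_real ((1 - \<alpha>) ^ (k - 1) * \<alpha>) * y t ^ k)"
    if jk: "1 \<le> j" "1 \<le> k" for j k
  proof -
    \<comment> \<open>Applied to the members of the family that occur in \<open>W j k\<close>, these functions multiply to \<open>W j k\<close>: the counts
      enter through indicators, the summands through exponentials.\<close>
    define h where "h i r = (case i of Nu_alpha \<Rightarrow> of_real (indicator {real k} r) | Nu_beta \<Rightarrow> of_real (indicator {real j} r)
       | _ \<Rightarrow> iexp (t * r))" for i and r :: real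
    let ?K = "insert Nu_alpha (insert Nu_beta (X_idx ` {1..j} \<union> Y_idx ` {1..k}))"
    have hm: "h i \<in> borel_measurable borel" for i unfolding h_def by (cases i) simp_all
    have hi: "norm (h i r) \<le> 1" for i r by (cases i) (auto simp: h_def indicator_def)
    have sub: "?K \<subseteq> ?I" by auto
    have indK: "indep_vars (\<lambda>_. borel) (\<lambda>i \<omega>. h i (sum_family \<nu>a \<nu>b X Y i \<omega>)) ?K"
      by (rule indep_vars_compose2[OF indep_vars_subset[OF ind sub] hm])
    have "(\<integral>\<omega>. (\<Prod>i\<in>?K. h i (sum_family \<nu>a \<nu>b X Y i \<omega>)) \<partial>N) = (\<Prod>i\<in>?K. \<integral>\<omega>. h i (sum_family \<nu>a \<nu>b X Y i \<omega>) \<partial>N)"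
    proof (rule indep_vars_lebesgue_integral[OF _ indK])
      fix i assume "i \<in> ?K"
      with indK have "(\<lambda>\<omega>. h i (sum_family \<nu>a \<nu>b X Y i \<omega>)) \<in> borel_measurable N"
        unfolding indep_vars_def by blast
      then show "integrable N (\<lambda>\<omega>. h i (sum_family \<nu>a \<nu>b X Y i \<omega>))"
        by (rule integrable_const_bound[where B=1, rotated]) (simp add: hi)
    qed simp
    moreover have prodK: "(\<Prod>i\<in>?K. c i) = c Nu_alpha * c Nu_beta * (\<Prod>l=1..j. c (X_idx l)) * (\<Prod>l=1..k. c (Y_idx l))"
      for c :: "sum_index \<Rightarrow> complex"
    proof -
      have "(\<Prod>i\<in>X_idx ` {1..j} \<union> Y_idx ` {1..k}. c i) = (\<Prod>i\<in>X_idx ` {1..j}. c i) * (\<Prod>i\<in>Y_idx ` {1..k}. c i)"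
        by (rule prod.union_disjoint) auto
      moreover have "(\<Prod>i\<in>X_idx ` {1..j}. c i) = (\<Prod>l=1..j. c (X_idx l))" "(\<Prod>i\<in>Y_idx ` {1..k}. c i) = (\<Prod>l=1..k. c (Y_idx l))"
        by (subst prod.reindex; simp add: inj_on_def)+
      moreover have "Nu_alpha \<notin> insert Nu_beta (X_idx ` {1..j} \<union> Y_idx ` {1..k})" "Nu_beta \<notin> X_idx ` {1..j} \<union> Y_idx ` {1..k}"
        by auto
      ultimately show ?thesis by (simp add: mult.assoc)
    qed
    moreover have "(\<Prod>i\<in>?K. h i (sum_family \<nu>a \<nu>b X Y i \<omega>)) = W j k \<omega>" for \<omega>
      unfolding prodK
      by (auto simp: h_def W_def SX_def SY_def exp_sum[symmetric] sum_distrib_left distrib_left exp_add scaleR_conv_of_real indicator_def)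
    moreover have "(\<integral>\<omega>. h Nu_alpha (sum_family \<nu>a \<nu>b X Y Nu_alpha \<omega>) \<partial>N) = of_real ((1 - \<alpha>) ^ (k - 1) * \<alpha>)"
    proof -
      have "(\<integral>\<omega>. h Nu_alpha (sum_family \<nu>a \<nu>b X Y Nu_alpha \<omega>) \<partial>N) = (\<integral>\<omega>. complex_of_real (indicator {\<omega>\<in>space N. \<nu>a \<omega> = k} \<omega>) \<partial>N)"
        by (intro Bochner_Integration.integral_cong) (auto simp: h_def indicator_def)
      also have "\<dots> = of_real (prob {\<omega>\<in>space N. \<nu>a \<omega> = k})"
        by (rule indicator_value) measurable
      finally show ?thesis using pk(1)[OF jk(2)] by simp
    qed
    moreover have "(\<integral>\<omega>. h Nu_beta (sum_family \<nu>a \<nu>b X Y Nu_beta \<omega>) \<partial>N) = of_real ((1 - \<beta>) ^ (j - 1) * \<beta>)"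
    proof -
      have "(\<integral>\<omega>. h Nu_beta (sum_family \<nu>a \<nu>b X Y Nu_beta \<omega>) \<partial>N) = (\<integral>\<omega>. complex_of_real (indicator {\<omega>\<in>space N. \<nu>b \<omega> = j} \<omega>) \<partial>N)"
        by (intro Bochner_Integration.integral_cong) (auto simp: h_def indicator_def)
      also have "\<dots> = of_real (prob {\<omega>\<in>space N. \<nu>b \<omega> = j})"
        by (rule indicator_value) measurable
      finally show ?thesis using pk(2)[OF jk(1)] by simp
    qed
    moreover have "(\<Prod>l=1..j. \<integral>\<omega>. h (X_idx l) (sum_family \<nu>a \<nu>b X Y (X_idx l) \<omega>) \<partial>N) = x t ^ j"
      using charX(1) by (simp add: h_def)
    moreover have "(\<Prod>l=1..k. \<integral>\<omega>. h (Y_idx l) (sum_family \<nu>a \<nu>b X Y (Y_idx l) \<omega>) \<partial>N) = y t ^ k"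
      using charX(2) by (simp add: h_def)
    ultimately show ?thesis by (simp add: mult_ac)
  qed
  have W_sum: "(\<Sum>j=1..n. \<Sum>k=1..n. W j k \<omega>) = (indicator {1..n} (\<nu>b \<omega>) * indicator {1..n} (\<nu>a \<omega>)) *\<^sub>R iexp (t * Z \<omega>)" for n \<omega>
  proof -
    have "W j k \<omega> = (if j = \<nu>b \<omega> then if k = \<nu>a \<omega> then iexp (t * Z \<omega>) else 0 else 0)" for j k
      by (auto simp: W_def Z_def indicator_def)
    then have "(\<Sum>k=1..n. W j k \<omega>) = (if j = \<nu>b \<omega> then indicator {1..n} (\<nu>a \<omega>) *\<^sub>R iexp (t * Z \<omega>) else 0)" for j
      by (cases "j = \<nu>b \<omega>") (auto simp: indicator_def)
    then show ?thesis by (simp add: indicator_def)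
  qed
  have lim: "(\<lambda>n. \<integral>\<omega>. (\<Sum>j=1..n. \<Sum>k=1..n. W j k \<omega>) \<partial>N) \<longlonglongrightarrow> (\<integral>\<omega>. iexp (t * Z \<omega>) \<partial>N)"
    unfolding W_sum
  proof (rule integral_dominated_convergence[where w="\<lambda>_. 1"])
    show "AE \<omega> in N. (\<lambda>n. (indicator {1..n} (\<nu>b \<omega>) * indicator {1..n} (\<nu>a \<omega>)) *\<^sub>R iexp (t * Z \<omega>)) \<longlonglongrightarrow> iexp (t * Z \<omega>)"
      using geometric_rv_AE_pos[OF prob_space_axioms geo(1) \<alpha>] geometric_rv_AE_pos[OF prob_space_axioms geo(2) \<beta>]
    proof (rule eventually_elim2)
      fix \<omega> assume *: "1 \<le> \<nu>a \<omega>" "1 \<le> \<nu>b \<omega>"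
      have "eventually (\<lambda>n. max (\<nu>a \<omega>) (\<nu>b \<omega>) \<le> n) sequentially" by (rule eventually_ge_at_top)
      then have "eventually (\<lambda>n. (indicator {1..n} (\<nu>b \<omega>) * indicator {1..n} (\<nu>a \<omega>)) *\<^sub>R iexp (t * Z \<omega>) = iexp (t * Z \<omega>)) sequentially"
        by (rule eventually_mono) (use * in \<open>auto simp: indicator_def\<close>)
      then show "(\<lambda>n. (indicator {1..n} (\<nu>b \<omega>) * indicator {1..n} (\<nu>a \<omega>)) *\<^sub>R iexp (t * Z \<omega>)) \<longlonglongrightarrow> iexp (t * Z \<omega>)"
        by (rule tendsto_eventually)
    qed
  qed (auto simp: indicator_def)
  have partial: "(\<integral>\<omega>. (\<Sum>j=1..n. \<Sum>k=1..n. W j k \<omega>) \<partial>N) =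
      (\<Sum>j=1..n. of_real ((1 - \<beta>) ^ (j - 1) * \<beta>) * x t ^ j) * (\<Sum>k=1..n. of_real ((1 - \<alpha>) ^ (k - 1) * \<alpha>) * y t ^ k)" for n
  proof -
    have "(\<integral>\<omega>. (\<Sum>j=1..n. \<Sum>k=1..n. W j k \<omega>) \<partial>N) = (\<Sum>j=1..n. \<Sum>k=1..n. integral\<^sup>L N (W j k))"
      by (simp add: W_int)
    also have "\<dots> = (\<Sum>j=1..n. \<Sum>k=1..n. (of_real ((1 - \<beta>) ^ (j - 1) * \<beta>) * x t ^ j) * (of_real ((1 - \<alpha>) ^ (k - 1) * \<alpha>) * y t ^ k))"
      by (intro sum.cong refl) (simp add: W_value)
    finally show ?thesis by (simp add: sum_product)
  qed
  have geom: "(\<lambda>n. \<Sum>j=1..n. of_real ((1 - c) ^ (j - 1) * c) * z ^ j) \<longlonglongrightarrow> c * z / (1 - (1 - c) * z)"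
    if c: "0 < c" "c < 1" and z: "norm z \<le> 1" for c :: real and z :: complex
  proof -
    have "norm ((1 - of_real c) * z) < 1"
    proof -
      have "norm (1 - complex_of_real c) = 1 - c" using c by (metis norm_of_real of_real_1 of_real_diff abs_of_pos diff_gt_0_iff_gt)
      then have "norm ((1 - of_real c) * z) \<le> (1 - c) * 1" using z c by (simp add: norm_mult mult_left_le)
      then show ?thesis using c by simp
    qed
    then have "(\<lambda>j. ((1 - of_real c) * z) ^ j) sums (1 / (1 - (1 - of_real c) * z))" by (rule geometric_sums)
    then have "(\<lambda>j. of_real c * z * ((1 - of_real c) * z) ^ j) sums (of_real c * z * (1 / (1 - (1 - of_real c) * z)))" by (rule sums_mult)
    then have "(\<lambda>n. \<Sum>j<n. of_real c * z * ((1 - of_real c) * z) ^ j) \<longlonglongrightarrow> c * z / (1 - (1 - c) * z)"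
      by (simp add: sums_def)
    moreover have "(\<Sum>j=1..n. of_real ((1 - c) ^ (j - 1) * c) * z ^ j) = (\<Sum>j<n. of_real c * z * ((1 - of_real c) * z) ^ j)" for n
    proof -
      define q where "q = 1 - complex_of_real c"
      have "(\<Sum>j=1..n. (q ^ (j - 1) * of_real c) * z ^ j) = (\<Sum>j<n. of_real c * z * (q * z) ^ j)"
        by (induction n) (simp_all add: power_mult_distrib mult_ac)
      then show ?thesis by (simp add: q_def)
    qed
    ultimately show ?thesis by simp
  qed
  have "norm (\<integral>\<omega>. iexp (t * X 1 \<omega>) \<partial>N) \<le> (\<integral>\<omega>. norm (iexp (t * X 1 \<omega>)) \<partial>N)"
    "norm (\<integral>\<omega>. iexp (t * Y 1 \<omega>) \<partial>N) \<le> (\<integral>\<omega>. norm (iexp (t * Y 1 \<omega>)) \<partial>N)"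
    by (rule integral_norm_bound)+
  then have norms: "norm (x t) \<le> 1" "norm (y t) \<le> 1"
    using charX[of 1] by (simp_all add: prob_space)
  have "(\<integral>\<omega>. iexp (t * Z \<omega>) \<partial>N) = (of_real \<beta> * x t / (1 - of_real (1 - \<beta>) * x t)) * (of_real \<alpha> * y t / (1 - of_real (1 - \<alpha>) * y t))"
    using LIMSEQ_unique[OF lim[unfolded partial] tendsto_mult[OF geom[OF \<beta> norms(1)] geom[OF \<alpha> norms(2)]]] by simp
  then show "char (distr N borel (\<lambda>\<omega>. (\<Sum>k=1..\<nu>b \<omega>. X k \<omega>) + (\<Sum>k=1..\<nu>a \<omega>. Y k \<omega>))) t =
    (of_real \<beta> * x t / (1 - of_real (1 - \<beta>) * x t)) * (of_real \<alpha> * y t / (1 - of_real (1 - \<alpha>) * y t))"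
    unfolding Z_eq char_def by (subst integral_distr) auto
qed

text \<open>Coordinates of a countable product space, with the index set of the family coded into the natural numbers.\<close>

lemma geometric_sum_data_exists:
  fixes fX fY :: "real \<Rightarrow> real"
  assumes \<alpha>: "0 < \<alpha>" "\<alpha> < 1" and \<beta>: "0 < \<beta>" "\<beta> < 1"
    and fX: "fX \<in> borel_measurable borel" "prob_space (density lborel (\<lambda>t. ennreal (fX t)))"
    and fY: "fY \<in> borel_measurable borel" "prob_space (density lborel (\<lambda>t. ennreal (fY t)))"
  shows "\<exists>(N :: (nat \<Rightarrow> real) measure) \<nu>a \<nu>b X Y. geometric_sum_data \<alpha> \<beta> fX fY N \<nu>a \<nu>b X Y"
proof -
  \<comment> \<open>The law \<open>geometric_pmf c\<close> counts failures and starts at \<open>0\<close>, hence the successor.\<close>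
  define geo where "geo c = distr (measure_pmf (geometric_pmf c)) borel (\<lambda>n. real (Suc n))" for c
  have geo_prob: "prob_space (geo c)" for c
    unfolding geo_def by (intro measure_pmf.prob_space_distr) simp
  define code :: "sum_index \<Rightarrow> nat" where "code i = (case i of Nu_alpha \<Rightarrow> 0 | Nu_beta \<Rightarrow> 1 | X_idx k \<Rightarrow> 2 * k + 2 | Y_idx k \<Rightarrow> 2 * k + 3)" for i
  define Q where "Q n = (if n = 0 then geo \<alpha> else if n = 1 then geo \<beta>
     else if even n then density lborel (\<lambda>t. ennreal (fX t)) else density lborel (\<lambda>t. ennreal (fY t)))" for n :: nat
  have Q_prob: "prob_space (Q n)" for n
    using geo_prob fX fY by (simp add: Q_def)
  have Q_sets[measurable_cong]: "sets (Q n) = sets borel" for n by (simp add: Q_def geo_def)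
  define N where "N = PiM UNIV Q"
  interpret N: prob_space N unfolding N_def by (rule prob_space_PiM[OF Q_prob])
  have coord[measurable]: "(\<lambda>\<omega>. \<omega> n) \<in> borel_measurable N" for n
    unfolding N_def by (simp add: measurable_cong_sets[OF refl Q_sets[of n, symmetric]])
  have law: "distr N borel (\<lambda>\<omega>. \<omega> n) = Q n" for n
  proof -
    have "distr N borel (\<lambda>\<omega>. \<omega> n) = distr N (Q n) (\<lambda>\<omega>. \<omega> n)"
      by (rule distr_cong) (simp_all add: Q_sets)
    then show ?thesis unfolding N_def using distr_PiM_component[OF Q_prob, of n UNIV] by simp
  qed
  have ind: "N.indep_vars (\<lambda>_. borel) (\<lambda>n \<omega>. \<omega> n) UNIV"
  proof (subst N.indep_vars_iff_distr_eq_PiM)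
    have "distr N (PiM UNIV (\<lambda>_. borel)) (\<lambda>\<omega>. restrict \<omega> UNIV) = distr N N (\<lambda>\<omega>. \<omega>)"
      by (rule distr_cong) (auto simp: N_def intro!: sets_PiM_cong Q_sets[symmetric])
    then show "distr N (PiM UNIV (\<lambda>_. borel)) (\<lambda>\<omega>. \<lambda>n\<in>UNIV. \<omega> n) = PiM UNIV (\<lambda>n. distr N borel (\<lambda>\<omega>. \<omega> n))"
      unfolding law by (simp add: N_def)
  qed simp_all
  \<comment> \<open>The coordinates are real; the counts are read off the first two by rounding.\<close>
  define \<nu> where "\<nu> n \<omega> = nat \<lfloor>\<omega> n\<rfloor>" for n :: nat and \<omega> :: "nat \<Rightarrow> real"
  have [measurable]: "\<nu> n \<in> measurable N (count_space UNIV)" for n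
    unfolding \<nu>_def by measurable
  have geo_rv: "geometric_rv N c (\<nu> n)" if Qn: "Q n = geo c" and c: "0 < c" "c < 1" for c n
    unfolding geometric_rv_def
  proof (intro conjI allI impI)
    fix k :: nat assume "1 \<le> k"
    then obtain l where l: "k = Suc l" by (cases k) auto
    have "measure N {\<omega>\<in>space N. \<nu> n \<omega> = k} = measure (distr N borel (\<lambda>\<omega>. \<omega> n)) {r. nat \<lfloor>r\<rfloor> = k}"
      by (subst measure_distr) (auto simp: \<nu>_def intro!: arg_cong[where f="measure N"])
    also have "\<dots> = measure (measure_pmf (geometric_pmf c)) {l}"
      unfolding law Qn geo_def
      by (subst measure_distr) (auto simp: l nat_eq_iff intro!: arg_cong[where f="measure _"])
    also have "\<dots> = (1 - c) ^ (k - 1) * c"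
      using c by (simp add: measure_pmf_single l)
    finally show "measure N {\<omega>\<in>space N. \<nu> n \<omega> = k} = (1 - c) ^ (k - 1) * c" .
  qed measurable
  have dist: "distributed N lborel (\<lambda>\<omega>. \<omega> n) (\<lambda>t. ennreal (f t))"
    if "Q n = density lborel (\<lambda>t. ennreal (f t))" and [measurable]: "f \<in> borel_measurable borel" for n f
  proof -
    have "distr N lborel (\<lambda>\<omega>. \<omega> n) = distr N borel (\<lambda>\<omega>. \<omega> n)" by (rule distr_cong) simp_all
    then show ?thesis unfolding distributed_def using law[of n] that by simp
  qed
  let ?I = "{Nu_alpha, Nu_beta} \<union> X_idx ` {1..} \<union> Y_idx ` {1..}"
  let ?X = "\<lambda>k (\<omega>::nat\<Rightarrow>real). \<omega> (code (X_idx k))" and ?Y = "\<lambda>k (\<omega>::nat\<Rightarrow>real). \<omega> (code (Y_idx k))"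
  have "inj_on code ?I"
    by (auto simp: inj_on_def code_def split: sum_index.splits) presburger+
  then have ind_code: "N.indep_vars (\<lambda>_. borel) (\<lambda>i \<omega>. \<omega> (code i)) ?I"
    by (intro N.indep_vars_reindex[OF ind]) auto
  define g :: "sum_index \<Rightarrow> real \<Rightarrow> real" where
    "g i r = (if i = Nu_alpha \<or> i = Nu_beta then real (nat \<lfloor>r\<rfloor>) else r)" for i r
  have floor: "(\<lambda>r::real. real (nat \<lfloor>r\<rfloor>)) \<in> borel_measurable borel"
    by (rule measurable_compose[OF measurable_real_floor]) simp
  have g: "g i \<in> borel_measurable borel" for i
    using floor by (cases "i = Nu_alpha \<or> i = Nu_beta") (simp_all add: g_def[abs_def])
  have "N.indep_vars (\<lambda>_. borel) (\<lambda>i \<omega>. g i (\<omega> (code i))) ?I"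
    by (rule N.indep_vars_compose2[OF ind_code g])
  also have "(\<lambda>i \<omega>. g i (\<omega> (code i))) = sum_family (\<nu> 0) (\<nu> 1) ?X ?Y"
  proof
    fix i show "(\<lambda>\<omega>. g i (\<omega> (code i))) = sum_family (\<nu> 0) (\<nu> 1) ?X ?Y i"
      by (cases i) (simp_all add: g_def \<nu>_def code_def)
  qed
  finally have "geometric_sum_data \<alpha> \<beta> fX fY N (\<nu> 0) (\<nu> 1) ?X ?Y"
    unfolding geometric_sum_data_def using \<alpha> \<beta> fX(1) fY(1)
    by (auto simp: N.prob_space_axioms code_def intro!: geo_rv dist) (auto simp: Q_def)
  then show ?thesis by blast
qed

section \<open>The representation of a full cycle\<close>

theorem theorem1:
  fixes P :: "'p measure" and Tp Tm :: "'p \<Rightarrow> real" and fp fm :: "real \<Rightarrow> real"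
    and M :: "'a measure" and \<delta> :: "'a \<Rightarrow> real" and Tps Tms :: "int \<Rightarrow> 'a \<Rightarrow> real"
    and D :: "real \<Rightarrow> 'a \<Rightarrow> real" and Ep Em :: "real \<Rightarrow> real"
    and \<mu>p \<mu>m \<alpha> \<beta> :: real and fX fY :: "real \<Rightarrow> real"
  assumes times: "switching_times P Tp Tm fp fm"
    and data: "switch_data P Tp Tm M \<delta> Tps Tms"
    and start_p: "measure M {\<omega>\<in>space M. \<delta> \<omega> = 1} > 0"
    and start_m: "measure M {\<omega>\<in>space M. \<delta> \<omega> = -1} > 0"
    and D: "D = switch_process \<delta> Tps Tms"
    and Ep: "Ep = expected_value M \<delta> D 1"
    and Em: "Em = expected_value M \<delta> D (-1)"
    and mono_p: "\<And>t. t > 0 \<Longrightarrow> Ep differentiable (at t) \<Longrightarrow> - deriv Ep t \<ge> 0"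
    and mono_m: "\<And>t. t > 0 \<Longrightarrow> Em differentiable (at t) \<Longrightarrow> deriv Em t \<ge> 0"
    and \<mu>p: "\<mu>p = integral\<^sup>L P Tp"
    and \<mu>m: "\<mu>m = integral\<^sup>L P Tm"
    and \<alpha>: "\<alpha> = \<mu>m / (\<mu>p + \<mu>m)"
    and \<beta>: "\<beta> = \<mu>p / (\<mu>p + \<mu>m)"
    and fX: "fX = scaled_deriv (- 1 / (2 * \<alpha>)) Ep"
    and fY: "fY = scaled_deriv (1 / (2 * \<beta>)) Em"
  shows "(\<exists>(N :: (nat \<Rightarrow> real) measure) \<nu>a \<nu>b X Y. geometric_sum_data \<alpha> \<beta> fX fY N \<nu>a \<nu>b X Y) \<and>
    (\<forall>(N :: 'n measure) \<nu>a \<nu>b X Y. geometric_sum_data \<alpha> \<beta> fX fY N \<nu>a \<nu>b X Y \<longrightarrow>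
       distr P borel (\<lambda>\<omega>. Tm \<omega> + Tp \<omega>) =
       distr N borel (\<lambda>\<omega>. (\<Sum>k=1..\<nu>b \<omega>. X k \<omega>) + (\<Sum>k=1..\<nu>a \<omega>. Y k \<omega>)))"
proof -
  interpret P: prob_space P using times by (simp add: switching_times_def)
  have Tp: "switching_time P Tp fp" and Tm: "switching_time P Tm fm"
    and indep: "P.indep_var borel Tp borel Tm"
    using times by (simp_all add: switching_times_def)
  define p m where "p = distr P borel Tp" and "m = distr P borel Tm"
  note pw = switching_time_waiting_law[OF P.prob_space_axioms Tp, folded p_def \<mu>p]
  note mw = switching_time_waiting_law[OF P.prob_space_axioms Tm, folded m_def \<mu>m]
  have \<mu>: "0 < \<mu>p" "0 < \<mu>m"
    using waiting_law_mean_pos[OF pw(1,2)] waiting_law_mean_pos[OF mw(1,2)] pw(3) mw(3) by simp_all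
  have \<alpha>\<beta>: "0 < \<alpha>" "\<alpha> < 1" "0 < \<beta>" "\<beta> < 1" "1 - \<alpha> = \<beta>" "1 - \<beta> = \<alpha>"
    using \<mu> by (simp_all add: \<alpha> \<beta> field_simps)
  have Ep': "Ep t = 1 + (-2) * renewal_cdf p m t" and Em': "Em t = -1 + 2 * renewal_cdf m p t" if "0 \<le> t" for t
    using expected_value_eq_renewal_cdf[OF data that, folded p_def m_def, OF pw(1) mw(1)] start_p start_m
    by (simp_all add: Ep Em D)
  have half: "renewal_density p m = scaled_deriv (-1/2) Ep"
    "renewal_density m p = scaled_deriv (1/2) Em"
    using scaled_deriv_affine[OF Ep'] scaled_deriv_affine[OF Em'] by simp_all
  have nonneg: "0 \<le> renewal_density p m t" "0 \<le> renewal_density m p t" for t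
    unfolding half using mono_p mono_m by (auto simp: scaled_deriv_def)
  have fX': "fX = (\<lambda>t. 1 / \<alpha> * renewal_density p m t)"
    and fY': "fY = (\<lambda>t. 1 / \<beta> * renewal_density m p t)"
    unfolding fX fY using scaled_deriv_affine[OF Ep'] scaled_deriv_affine[OF Em'] by simp_all
  note X = normalised_renewal_density[OF pw(1) mw(1) pw(2) mw(2) nonneg(1) _ fX', unfolded pw(3) mw(3), OF \<alpha>]
  have \<beta>': "\<beta> = \<mu>p / (\<mu>m + \<mu>p)" by (simp add: \<beta> add.commute)
  note Y = normalised_renewal_density[OF mw(1) pw(1) mw(2) pw(2) nonneg(2) _ fY', unfolded pw(3) mw(3), OF \<beta>']
  have "distr P borel (\<lambda>\<omega>. Tm \<omega> + Tp \<omega>) =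
       distr N borel (\<lambda>\<omega>. (\<Sum>k=1..\<nu>b \<omega>. X k \<omega>) + (\<Sum>k=1..\<nu>a \<omega>. Y k \<omega>))"
    if G: "geometric_sum_data \<alpha> \<beta> fX fY N \<nu>a \<nu>b X Y" for N :: "'n measure" and \<nu>a \<nu>b X Y
  proof (rule Levy_uniqueness)
    interpret N: prob_space N using G by (simp add: geometric_sum_data_def)
    note GS = char_geometric_sums[OF G \<alpha>\<beta>(1-4), unfolded \<alpha>\<beta>(5,6)]
    have [measurable]: "Tp \<in> borel_measurable P" "Tm \<in> borel_measurable P"
      using Tp Tm by (simp_all add: switching_time_def)
    show lhs: "real_distribution (distr P borel (\<lambda>\<omega>. Tm \<omega> + Tp \<omega>))"
      by (simp add: real_distribution_def real_distribution_axioms_def P.prob_space_distr)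
    show rhs: "real_distribution (distr N borel (\<lambda>\<omega>. (\<Sum>k=1..\<nu>b \<omega>. X k \<omega>) + (\<Sum>k=1..\<nu>a \<omega>. Y k \<omega>)))"
      unfolding real_distribution_def real_distribution_axioms_def by (intro conjI N.prob_space_distr GS(2)) simp_all
    show "char (distr P borel (\<lambda>\<omega>. Tm \<omega> + Tp \<omega>)) =
        char (distr N borel (\<lambda>\<omega>. (\<Sum>k=1..\<nu>b \<omega>. X k \<omega>) + (\<Sum>k=1..\<nu>a \<omega>. Y k \<omega>)))"
    proof
      fix t
      define a b where "a = char p t" and "b = char m t"
      define x y where "x = char (density lborel (\<lambda>t. ennreal (fX t))) t" and "y = char (density lborel (\<lambda>t. ennreal (fY t))) t"
      have sum: "char (distr P borel (\<lambda>\<omega>. Tm \<omega> + Tp \<omega>)) t = a * b"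
        using P.char_distr_add[OF indep, of t] by (simp add: a_def b_def p_def m_def add.commute)
      show "char (distr P borel (\<lambda>\<omega>. Tm \<omega> + Tp \<omega>)) t =
          char (distr N borel (\<lambda>\<omega>. (\<Sum>k=1..\<nu>b \<omega>. X k \<omega>) + (\<Sum>k=1..\<nu>a \<omega>. Y k \<omega>))) t"
      proof (cases "t = 0")
        case True
        then show ?thesis using real_distribution.char_zero[OF lhs] real_distribution.char_zero[OF rhs] by simp
      next
        case False
        have "char (p \<star> m) t = a * b"
          unfolding a_def b_def using waiting_lawD[OF pw(1)] waiting_lawD[OF mw(1)] by (intro char_convolution) simp_all
        then have neq: "a \<noteq> 1" "b \<noteq> 1" "a * b \<noteq> 1"
          using waiting_law_char_neq_1[OF pw(1) False] waiting_law_char_neq_1[OF mw(1) False]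
            waiting_law_char_neq_1[OF waiting_law_convolution[OF pw(1) mw(1)] False] by (simp_all add: a_def b_def)
        \<comment> \<open>The characteristic functions of the summands are rational in \<open>a\<close> and \<open>b\<close>; in the product below all factors but \<open>a b\<close> cancel.\<close>
        have x: "\<alpha> * x = a * (1 - b) / (1 - a * b)" and y: "\<beta> * y = b * (1 - a) / (1 - a * b)"
          using X(3)[of t] Y(3)[of t] neq by (simp_all add: x_def y_def a_def b_def field_simps)
        have x1: "1 - \<alpha> * x = (1 - a) / (1 - a * b)" and y1: "1 - \<beta> * y = (1 - b) / (1 - a * b)"
          unfolding x y using neq by (simp_all add: field_simps)
        have "(\<beta> * x / (1 - \<alpha> * x)) * (\<alpha> * y / (1 - \<beta> * y)) = (\<alpha> * x) * (\<beta> * y) / ((1 - \<alpha> * x) * (1 - \<beta> * y))"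
          by simp
        also have "\<dots> = a * b"
          unfolding x1 y1 unfolding x y using neq by (simp add: divide_simps)
        finally show ?thesis
          unfolding sum GS(1) x_def y_def by simp
      qed
    qed
  qed
  moreover have "\<exists>(N :: (nat \<Rightarrow> real) measure) \<nu>a \<nu>b X Y. geometric_sum_data \<alpha> \<beta> fX fY N \<nu>a \<nu>b X Y"
    by (rule geometric_sum_data_exists[OF \<alpha>\<beta>(1-4) X(1,2) Y(1,2)])
  ultimately show ?thesis by blast
qed

end
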